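(* Let $T$ be the $5$-regular tree, let $c$ be a legal coloring of $T$, and fix an edge $e$ of $T$. Let $H^+=\mathrm{Aut}^+(T)$ be the group of type-preserving automorphisms of $T$, let $L=U_c(\mathrm{Alt}(5))$, and let $L_{(e)}\cong W(\mathrm{Alt}(4))\times W(\mathrm{Alt}(4))$ be the stabilizer of $e$ in $L$. Let $U=W(V)\times W(V)\leq L_{(e)}$, where $V\trianglelefteq\mathrm{Alt}(4)$ is the Klein four group; $U$ is a pro-$2$-Sylow subgroup of $L_{(e)}$. Let $G=\mathrm{Comm}_{H^+}(U)$ be endowed with the $U$-localized topology, and let $M=\mathrm{Mon}(G)$ be the monolith of $G$. Then $M$ is not $\sigma$-compact.
   Context: $ET$ is the set of directed edges of $T$, $VT$ its vertex set, $\overline{e}$ the reverse of the edge $e$, and $E(v)$ the set of edges with initial vertex $v$. A coloring is a map $c\colon ET\to\{1,\dots,5\}$ whose restriction $c_v$ to each $E(v)$ is a bijection; it is legal if $c(e)=c(\overline{e})$ for all $e\in ET$. The local action of $g\in\mathrm{Aut}(T)$ at $v$ is $\sigma_c(g,v)=c_{g(v)}\circ g\circ c_v^{-1}\in\mathrm{Sym}(5)$, and for $F\leq\mathrm{Sym}(5)$, $U_c(F)=\{g\in\mathrm{Aut}(T)\mid\sigma_c(g,v)\in F\ \text{for all } v\in VT\}$. Stabilizers of edges fix both endpoints. For a finite permutation group $F\leq\mathrm{Sym}(n)$, $W(F)$ is the profinite wreath branch group given by $F$: the projective limit of iterated permutational wreath products of $F$ with itself. If $F\leq J\leq\mathrm{Sym}(n)$,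 then $W(F)$ is viewed as a closed subgroup of $W(J)$. The two factors of $L_{(e)}\cong W(\mathrm{Alt}(4))^2$ act on the two half-trees determined by $e$. For a group $X$ and a subgroup $K\leq X$, $\mathrm{Comm}_X(K)$ is the set of $g\in X$ such that $K\cap gKg^{-1}$ has finite index in both $K$ and $gKg^{-1}$. If $K$ is a compact subgroup of a totally disconnected locally compact group $X$, then $\mathrm{Comm}_X(K)$ admits a unique totally disconnected locally compact group topology such that the inclusion $K\to\mathrm{Comm}_X(K)$ is continuous and open; this is the $K$-localized topology. A locally compact group is monolithic if the intersection of all its non-trivial closed normal subgroups is non-trivial, and this intersection is the monolith $\mathrm{Mon}(\cdot)$. The group $G$ of the claim is monolithic with non-discrete topologically simple monolith. *)

theory Defs
  imports
    "HOL-Analysis.Analysis"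
    "HOL-Algebra.Sym_Groups"
    "Graph_Theory.Graph_Theory"
begin

section \<open>Regular trees and their automorphisms\<close>

text \<open>
  An edge of a graph is stored as its two orientations \<open>(x, y)\<close> and \<open>(y, x)\<close>, so
  \<^const>\<open>prod.swap\<close> is edge reversal.  The predicate \<open>tree\<close> of the graph library forbids every
  directed cycle and hence fails for graphs with both orientations; here the cycles of length 2,
  which traverse an edge back and forth, have to be admitted.
\<close>

definition regular_tree :: "nat \<Rightarrow> 'v pair_pre_digraph \<Rightarrow> bool" where
  "regular_tree d T \<longleftrightarrow>
     pair_bidirected_digraph T \<and>
     strongly_connected (with_proj T) \<and>
     (\<forall>p. pre_digraph.cycle (with_proj T) p \<longrightarrow> length p \<le> 2) \<and>
     (\<forall>v\<in>pverts T. card (out_arcs (with_proj T) v) = d)"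

text \<open>Automorphisms are extended by the identity outside the vertex set, as in \<^term>\<open>(permutes)\<close>.\<close>

definition tree_aut :: "'v pair_pre_digraph \<Rightarrow> ('v \<Rightarrow> 'v) set" where
  "tree_aut T = {g. g permutes pverts T \<and>
     (\<forall>u\<in>pverts T. \<forall>v\<in>pverts T. (g u, g v) \<in> parcs T \<longleftrightarrow> (u, v) \<in> parcs T)}"

definition vertex_types :: "'v pair_pre_digraph \<Rightarrow> ('v \<Rightarrow> bool) \<Rightarrow> bool" where
  "vertex_types T t \<longleftrightarrow> (\<forall>(u, v)\<in>parcs T. t u \<noteq> t v)"

definition tree_aut_plus :: "'v pair_pre_digraph \<Rightarrow> ('v \<Rightarrow> 'v) set" where
  "tree_aut_plus T =
     {g \<in> tree_aut T. \<forall>t. vertex_types T t \<longrightarrow> (\<forall>v\<in>pverts T. t (g v) = t v)}"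

definition perm_group :: "('v \<Rightarrow> 'v) set \<Rightarrow> ('v \<Rightarrow> 'v) monoid" where
  "perm_group S = \<lparr>carrier = S, mult = (\<circ>), one = id\<rparr>"

text \<open>The permutation topology, that is, pointwise convergence for the discrete topology on
  points.\<close>

definition perm_topology :: "('v \<Rightarrow> 'v) set \<Rightarrow> ('v \<Rightarrow> 'v) topology" where
  "perm_topology S = subtopology (product_topology (\<lambda>_. discrete_topology UNIV) UNIV) S"

definition edge_stabilizer :: "'v \<times> 'v \<Rightarrow> ('v \<Rightarrow> 'v) set \<Rightarrow> ('v \<Rightarrow> 'v) set" where
  "edge_stabilizer e S = {g \<in> S. g (fst e) = fst e \<and> g (snd e) = snd e}"


section \<open>Legal colorings and universal groups\<close>

definition legal_coloring :: "nat \<Rightarrow> 'v pair_pre_digraph \<Rightarrow> ('v \<times> 'v \<Rightarrow> nat) \<Rightarrow> bool" where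
  "legal_coloring d T c \<longleftrightarrow>
     (\<forall>v\<in>pverts T. bij_betw c (out_arcs (with_proj T) v) {1..d}) \<and>
     (\<forall>a\<in>parcs T. c (prod.swap a) = c a)"

definition local_action ::
    "nat \<Rightarrow> 'v pair_pre_digraph \<Rightarrow> ('v \<times> 'v \<Rightarrow> nat) \<Rightarrow> ('v \<Rightarrow> 'v) \<Rightarrow> 'v \<Rightarrow> nat \<Rightarrow> nat" where
  "local_action d T c g v i =
     (if i \<in> {1..d} then c (map_prod g g (inv_into (out_arcs (with_proj T) v) c i)) else i)"

definition universal_group ::
    "nat \<Rightarrow> 'v pair_pre_digraph \<Rightarrow> ('v \<times> 'v \<Rightarrow> nat) \<Rightarrow> (nat \<Rightarrow> nat) set \<Rightarrow> ('v \<Rightarrow> 'v) set" where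
  "universal_group d T c F = {g \<in> tree_aut T. \<forall>v\<in>pverts T. local_action d T c g v \<in> F}"


section \<open>Profinite wreath branch groups\<close>

definition word_level :: "nat \<Rightarrow> nat \<Rightarrow> nat list set" where
  "word_level n k = {w \<in> lists {1..n}. length w = k}"

text \<open>
  The \<open>k\<close>-fold iterated permutational wreath product of \<open>F\<close>, acting on words of length \<open>k\<close>:
  an element of level \<open>k + 1\<close> consists of \<open>h\<close> of level \<open>k\<close> and a family \<open>f\<close> in \<open>F\<close> indexed by
  the words of length \<open>k\<close>.
\<close>

primrec iter_wreath :: "nat \<Rightarrow> (nat \<Rightarrow> nat) set \<Rightarrow> nat \<Rightarrow> (nat list \<Rightarrow> nat list) set" where
  "iter_wreath n F 0 = {id}"
| "iter_wreath n F (Suc k) =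
     {g. g permutes word_level n (Suc k) \<and>
        (\<exists>h\<in>iter_wreath n F k. \<exists>f. \<forall>w\<in>word_level n k.
           f w \<in> F \<and> (\<forall>i\<in>{1..n}. g (w @ [i]) = h w @ [f w i]))}"

text \<open>
  The projective limit of these groups: a coherent sequence \<open>h\<close> is recorded as the permutation it
  induces on the set of all words, the \<open>n\<close>-regular rooted tree.
\<close>

definition wreath_branch :: "nat \<Rightarrow> (nat \<Rightarrow> nat) set \<Rightarrow> (nat list \<Rightarrow> nat list) set" where
  "wreath_branch n F =
     {g. g permutes lists {1..n} \<and>
        (\<exists>h. (\<forall>k. h k \<in> iter_wreath n F k) \<and>
             (\<forall>k. \<forall>w\<in>word_level n (Suc k). butlast (h (Suc k) w) = h k (butlast w)) \<and>
             (\<forall>w\<in>lists {1..n}. g w = h (length w) w))}"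

definition klein_four :: "(nat \<Rightarrow> nat) set" where
  "klein_four = {id,
     Transposition.transpose 1 2 \<circ> Transposition.transpose 3 4,
     Transposition.transpose 1 3 \<circ> Transposition.transpose 2 4,
     Transposition.transpose 1 4 \<circ> Transposition.transpose 2 3}"


section \<open>Products of wreath branch groups acting on the two half-trees of an edge\<close>

text \<open>The half-tree at the initial vertex of \<open>e\<close>; the opposite one belongs to the reverse of \<open>e\<close>.\<close>

definition half_tree :: "'v pair_pre_digraph \<Rightarrow> 'v \<times> 'v \<Rightarrow> 'v set" where
  "half_tree T e =
     {v. reachable (with_proj \<lparr>pverts = pverts T, parcs = parcs T - {e, prod.swap e}\<rparr>) (fst e) v}"

definition half_tree_coords ::
    "nat \<Rightarrow> 'v pair_pre_digraph \<Rightarrow> 'v \<times> 'v \<Rightarrow> (nat list \<Rightarrow> 'v) \<Rightarrow> bool" where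
  "half_tree_coords n T e \<alpha> \<longleftrightarrow>
     bij_betw \<alpha> (lists {1..n}) (half_tree T e) \<and> \<alpha> [] = fst e \<and>
     (\<forall>u\<in>lists {1..n}. \<forall>w\<in>lists {1..n}.
        (\<alpha> u, \<alpha> w) \<in> parcs T \<longleftrightarrow> (\<exists>i. w = u @ [i] \<or> u = w @ [i]))"

definition half_trees_action ::
    "nat \<Rightarrow> 'v pair_pre_digraph \<Rightarrow> 'v \<times> 'v \<Rightarrow> (nat list \<Rightarrow> 'v) \<Rightarrow> (nat list \<Rightarrow> 'v) \<Rightarrow>
     (nat list \<Rightarrow> nat list) \<times> (nat list \<Rightarrow> nat list) \<Rightarrow> 'v \<Rightarrow> 'v" where
  "half_trees_action n T e \<alpha> \<beta> = (\<lambda>(a, b) v.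
     if v \<in> half_tree T e then \<alpha> (a (inv_into (lists {1..n}) \<alpha> v))
     else if v \<in> half_tree T (prod.swap e) then \<beta> (b (inv_into (lists {1..n}) \<beta> v))
     else v)"

definition wreath_square ::
    "nat \<Rightarrow> 'v pair_pre_digraph \<Rightarrow> 'v \<times> 'v \<Rightarrow> (nat list \<Rightarrow> 'v) \<Rightarrow> (nat list \<Rightarrow> 'v) \<Rightarrow>
     (nat \<Rightarrow> nat) set \<Rightarrow> ('v \<Rightarrow> 'v) set" where
  "wreath_square n T e \<alpha> \<beta> F =
     half_trees_action n T e \<alpha> \<beta> ` (wreath_branch n F \<times> wreath_branch n F)"


section \<open>Commensurators, localized topologies and monoliths\<close>

definition finite_index :: "('a, 'b) monoid_scheme \<Rightarrow> 'a set \<Rightarrow> 'a set \<Rightarrow> bool" where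
  "finite_index X H K \<longleftrightarrow> finite (rcosets\<^bsub>X\<lparr>carrier := K\<rparr>\<^esub> H)"

definition conjugate_set :: "('a, 'b) monoid_scheme \<Rightarrow> 'a \<Rightarrow> 'a set \<Rightarrow> 'a set" where
  "conjugate_set X g K = (\<lambda>k. g \<otimes>\<^bsub>X\<^esub> k \<otimes>\<^bsub>X\<^esub> inv\<^bsub>X\<^esub> g) ` K"

definition commensurator :: "('a, 'b) monoid_scheme \<Rightarrow> 'a set \<Rightarrow> 'a set" where
  "commensurator X K = {g \<in> carrier X.
     finite_index X (K \<inter> conjugate_set X g K) K \<and>
     finite_index X (K \<inter> conjugate_set X g K) (conjugate_set X g K)}"

definition topological_group :: "('a, 'b) monoid_scheme \<Rightarrow> 'a topology \<Rightarrow> bool" where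
  "topological_group G \<tau> \<longleftrightarrow>
     group G \<and> topspace \<tau> = carrier G \<and>
     continuous_map (prod_topology \<tau> \<tau>) \<tau> (\<lambda>(x, y). x \<otimes>\<^bsub>G\<^esub> y) \<and>
     continuous_map \<tau> \<tau> (\<lambda>x. inv\<^bsub>G\<^esub> x)"

definition totally_disconnected_space :: "'a topology \<Rightarrow> bool" where
  "totally_disconnected_space \<tau> \<longleftrightarrow> (\<forall>x\<in>topspace \<tau>. connected_component_of_set \<tau> x = {x})"

definition tdlc_group :: "('a, 'b) monoid_scheme \<Rightarrow> 'a topology \<Rightarrow> bool" where
  "tdlc_group G \<tau> \<longleftrightarrow>
     topological_group G \<tau> \<and> Hausdorff_space \<tau> \<and> totally_disconnected_space \<tau> \<and>
     locally_compact_space \<tau>"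

text \<open>\<open>\<tau>\<close> is the \<open>K\<close>-localized topology on the commensurator of \<open>K\<close> in the group \<open>X\<close>, whose own
  topology is \<open>\<sigma>\<close>.\<close>

definition localized_topology ::
    "('a, 'b) monoid_scheme \<Rightarrow> 'a topology \<Rightarrow> 'a set \<Rightarrow> 'a topology \<Rightarrow> bool" where
  "localized_topology X \<sigma> K \<tau> \<longleftrightarrow>
     tdlc_group (X\<lparr>carrier := commensurator X K\<rparr>) \<tau> \<and>
     continuous_map (subtopology \<sigma> K) \<tau> (\<lambda>x. x) \<and>
     open_map (subtopology \<sigma> K) \<tau> (\<lambda>x. x)"

definition monolith :: "('a, 'b) monoid_scheme \<Rightarrow> 'a topology \<Rightarrow> 'a set" where
  "monolith G \<tau> =
     {x \<in> carrier G. \<forall>N. N \<lhd> G \<and> closedin \<tau> N \<and> N \<noteq> {\<one>\<^bsub>G\<^esub>} \<longrightarrow> x \<in> N}"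

definition sigma_compact_space :: "'a topology \<Rightarrow> bool" where
  "sigma_compact_space \<tau> \<longleftrightarrow>
     (\<exists>\<K>. countable \<K> \<and> (\<forall>C\<in>\<K>. compactin \<tau> C) \<and> \<Union>\<K> = topspace \<tau>)"

end

theory Submission
  imports Defs
begin

text \<open>
  The theorem holds because every non-trivial normal subgroup of \<open>G\<close> contains the same
  uncountable family of elements, which lie in pairwise different cosets of the open subgroup \<open>U\<close>.
  A \<open>\<sigma>\<close>-compact set meets only countably many cosets of an open subgroup.

  The group \<open>G\<close> is this large because \<open>Sym(4)\<close> normalizes the Klein group \<open>V\<close>.  Take a
  cone of the tree, that is, the descendants of a vertex, and let an automorphism act on it by one permutation \<open>s j\<close>
  of the four children at all vertices of depth \<open>j\<close>.  Elements of \<open>U\<close> that fix the apex preserve the depth, so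
  conjugation by this automorphism replaces a local action \<open>f \<in> V\<close> by a conjugate of \<open>f\<close> under \<open>s j\<close>, which is again in \<open>V\<close>.
  Hence a finite index subgroup of \<open>U\<close> is conjugated into \<open>U\<close>, and every sequence \<open>s\<close> gives an
  element of \<open>G\<close> (\<open>cone_twist_commensurating\<close>, \<open>lift_commensurator\<close>).  Modulo \<open>U\<close> such an element remembers the
  class of each \<open>s j\<close> in \<open>Sym(4) / V \<cong> Sym(3)\<close>, which is not abelian; so already commutators of
  such elements fill uncountably many cosets (\<open>selected_twist_coset\<close>).

  To place these commutators in an arbitrary non-trivial normal subgroup \<open>N\<close>, note that a non-trivial
  tree automorphism carries some cone off itself (\<open>moved_cone_disjoint\<close>).  The group \<open>G\<close> also contains
  the even powers of a translation that replaces prefixes of words, and together with \<open>U\<close>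
  these move one fixed cone into any given cone (\<open>cone_absorbed\<close>).  After
  conjugation, \<open>N\<close> contains an element displacing the fixed cone, and the double commutator trick
  puts the commutators of all elements of \<open>G\<close> supported on that cone into \<open>N\<close> (\<open>commutator_in_normal\<close>).

  All this is carried out on pairs of a side and a word, a model of the tree in
  which \<open>U\<close> is given by a condition on local actions.  That \<open>\<alpha>\<close> and \<open>\<beta>\<close> identify the model with \<open>T\<close> is shown
  in the locale \<open>edge_coordinates\<close>, and \<open>wreath_square_klein_four\<close> identifies \<open>U\<close>.
\<close>

(* The letters of words are the numerals 1, ..., 4, so 1 must not be rewritten to Suc 0. *)
declare One_nat_def [simp del]
(* Membership in lists {1..4} is kept as one atom instead of being unfolded letter by letter. *)
declare in_listsI [rule del] in_listsD [rule del]

section \<open>The Klein four-group and its normalizer\<close>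

lemma permutes_four_eqI:
  assumes "f permutes {1..4}" "g permutes {1..4}"
    and "f 1 = g 1" "f 2 = g 2" "f 3 = g 3" "f 4 = g (4::nat)"
  shows "f = g"
proof
  fix x :: nat
  consider "x = 1" | "x = 2" | "x = 3" | "x = 4" | "x \<notin> {1..4}" by force
  then show "f x = g x"
    by cases (use assms(3-6) permutes_not_in[OF assms(1)] permutes_not_in[OF assms(2)] in auto)
qed

lemma klein_four_permutes: "f \<in> klein_four \<Longrightarrow> f permutes {1..4}"
  by (auto simp: klein_four_def intro!: permutes_compose permutes_id permutes_swap_id)

text \<open>
  The value table turns every identity between elements of the Klein group into a finite lookup.
\<close>

lemma klein_four_iff:
  "f \<in> klein_four \<longleftrightarrow> f permutes {1..4} \<and>
     (f 1, f 2, f 3, f 4) \<in> {(1, 2, 3, 4), (2, 1, 4, 3), (3, 4, 1, 2), (4, 3, 2, 1)}"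
    (is "_ \<longleftrightarrow> _ \<and> ?table f")
proof
  assume f: "f \<in> klein_four"
  have "\<forall>f\<in>klein_four. ?table f"
    unfolding klein_four_def ball_simps by (simp add: Transposition.transpose_def)
  then show "f permutes {1..4} \<and> ?table f" using f klein_four_permutes by blast
next
  assume f: "f permutes {1..4} \<and> ?table f"
  have "\<exists>g\<in>klein_four. (g 1, g 2, g 3, g 4) = (f 1, f 2, f 3, f 4)"
  proof -
    have "\<forall>q\<in>{(1, 2, 3, 4), (2, 1, 4, 3), (3, 4, 1, 2), (4, 3, 2, 1)}.
        \<exists>g\<in>klein_four. (g 1, g 2, g 3, g 4) = q"
      unfolding klein_four_def ball_simps bex_simps by (simp add: Transposition.transpose_def)
    then show ?thesis using f by blast
  qed
  then obtain g where "g \<in> klein_four" "g 1 = f 1" "g 2 = f 2" "g 3 = f 3" "g 4 = f 4" by auto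
  moreover from this have "g = f"
    using f klein_four_permutes by (intro permutes_four_eqI) auto
  ultimately show "f \<in> klein_four" by simp
qed

lemma klein_four_involution:
  assumes "f \<in> klein_four" shows "f (f i) = i"
proof -
  have f: "f permutes {1..4}" using klein_four_permutes[OF assms] .
  have "(f 1, f 2, f 3, f 4) \<in> {(1, 2, 3, 4), (2, 1, 4, 3), (3, 4, 1, 2), (4, 3, 2, 1)}"
    using assms unfolding klein_four_iff by blast
  then have "f (f 1) = 1" "f (f 2) = 2" "f (f 3) = 3" "f (f 4) = 4"
    by (elim insertE emptyE; simp)+
  then have "f \<circ> f = id"
    by (intro permutes_four_eqI permutes_compose[OF f f] permutes_id) simp_all
  then show ?thesis by (simp add: fun_eq_iff)
qed

lemma klein_four_id: "id \<in> klein_four"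
  by (simp add: klein_four_def)

lemma klein_four_comp:
  assumes "f \<in> klein_four" "g \<in> klein_four" shows "f \<circ> g \<in> klein_four"
proof -
  have "f permutes {1..4}" "g permutes {1..4}"
    using assms klein_four_permutes by auto
  then have "f \<circ> g permutes {1..4}" by (intro permutes_compose)
  moreover have "(f 1, f 2, f 3, f 4) \<in> {(1, 2, 3, 4), (2, 1, 4, 3), (3, 4, 1, 2), (4, 3, 2, 1)}"
    "(g 1, g 2, g 3, g 4) \<in> {(1, 2, 3, 4), (2, 1, 4, 3), (3, 4, 1, 2), (4, 3, 2, 1)}"
    using assms unfolding klein_four_iff by blast+
  then have "((f \<circ> g) 1, (f \<circ> g) 2, (f \<circ> g) 3, (f \<circ> g) 4)
      \<in> {(1, 2, 3, 4), (2, 1, 4, 3), (3, 4, 1, 2), (4, 3, 2, 1)}"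
    by (elim insertE emptyE; simp)
  ultimately show ?thesis unfolding klein_four_iff by blast
qed

lemma klein_four_transitive:
  assumes "i \<in> {1..4}" shows "\<exists>f\<in>klein_four. f 1 = i"
proof -
  have "i = 1 \<or> i = 2 \<or> i = 3 \<or> i = 4" using assms by auto
  then show ?thesis by (auto simp: klein_four_def Transposition.transpose_def)
qed

text \<open>
  The Klein group acts regularly on the four letters.  This is what separates its elements from the
  3-cycles of \<open>Sym(4)\<close>, which fix a letter.
\<close>

lemma klein_four_fixed_point:
  assumes "f \<in> klein_four" "i \<in> {1..4}" "f i = i" shows "f = id"
proof -
  have "i = 1 \<or> i = 2 \<or> i = 3 \<or> i = 4" using assms by auto
  then have "f 1 = 1 \<and> f 2 = 2 \<and> f 3 = 3 \<and> f 4 = 4"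
    using assms(1,3) by (auto simp: klein_four_iff)
  then show ?thesis using klein_four_permutes[OF assms(1)]
    by (intro permutes_four_eqI) (auto intro: permutes_id)
qed

text \<open>
  All of \<open>Sym(4)\<close> normalizes the Klein group, but two transpositions and their products are enough
  to produce the elements used below.  Both directions of conjugation are recorded because an
  element has to commensurate together with its inverse.
\<close>

definition klein_normalizer :: "(nat \<Rightarrow> nat) set" where
  "klein_normalizer = {s. s permutes {1..4} \<and>
     (\<forall>f\<in>klein_four. s \<circ> f \<circ> inv_into UNIV s \<in> klein_four \<and> inv_into UNIV s \<circ> f \<circ> s \<in> klein_four)}"

lemma klein_normalizer_id: "id \<in> klein_normalizer"
  by (auto simp: klein_normalizer_def permutes_id)

lemma klein_normalizer_inv:
  assumes "s \<in> klein_normalizer" shows "inv_into UNIV s \<in> klein_normalizer"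
  using assms by (auto simp: klein_normalizer_def permutes_inv permutes_inv_inv)

lemma klein_normalizer_comp:
  assumes "s \<in> klein_normalizer" "t \<in> klein_normalizer" shows "s \<circ> t \<in> klein_normalizer"
proof -
  have st: "s permutes {1..4}" "t permutes {1..4}"
    using assms by (auto simp: klein_normalizer_def)
  have i: "inv_into UNIV (s \<circ> t) = inv_into UNIV t \<circ> inv_into UNIV s"
    by (rule o_inv_distrib[OF permutes_bij permutes_bij]) (use st in auto)
  have "(s \<circ> t) \<circ> f \<circ> inv_into UNIV (s \<circ> t) \<in> klein_four \<and> inv_into UNIV (s \<circ> t) \<circ> f \<circ> (s \<circ> t) \<in> klein_four"
    if f: "f \<in> klein_four" for f
  proof -
    have "s \<circ> (t \<circ> f \<circ> inv_into UNIV t) \<circ> inv_into UNIV s \<in> klein_four" "inv_into UNIV t \<circ> (inv_into UNIV s \<circ> f \<circ> s) \<circ> t \<in> klein_four"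
      using assms f unfolding klein_normalizer_def by blast+
    then show ?thesis unfolding i by (simp add: comp_assoc)
  qed
  then show ?thesis using st by (auto simp: klein_normalizer_def intro: permutes_compose)
qed

lemma klein_normalizer_transposition:
  assumes ab: "(a, b) \<in> {(1, 2), (2, 3)}"
  shows "Transposition.transpose a b \<in> klein_normalizer"
proof -
  let ?s = "Transposition.transpose a b"
  have s: "?s permutes {1..4}" using ab by (auto intro: permutes_swap_id)
  have "?s \<circ> f \<circ> ?s \<in> klein_four" if f: "f \<in> klein_four" for f
  proof -
    have "?s \<circ> f \<circ> ?s permutes {1..4}"
      by (intro permutes_compose s klein_four_permutes f)
    moreover have "(f 1, f 2, f 3, f 4) \<in> {(1, 2, 3, 4), (2, 1, 4, 3), (3, 4, 1, 2), (4, 3, 2, 1)}"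
      using f unfolding klein_four_iff by blast
    then have "((?s \<circ> f \<circ> ?s) 1, (?s \<circ> f \<circ> ?s) 2, (?s \<circ> f \<circ> ?s) 3, (?s \<circ> f \<circ> ?s) 4)
        \<in> {(1, 2, 3, 4), (2, 1, 4, 3), (3, 4, 1, 2), (4, 3, 2, 1)}"
      using ab by (elim insertE emptyE; simp add: Transposition.transpose_def)
    ultimately show ?thesis unfolding klein_four_iff by blast
  qed
  then show ?thesis using s by (auto simp: klein_normalizer_def)
qed

section \<open>The 5-regular tree in coordinates\<close>

text \<open>
  The vertex \<open>(b, w)\<close> lies on the side \<open>b\<close> of the distinguished edge, whose endpoints are
  \<open>(True, [])\<close> and \<open>(False, [])\<close>, and \<open>w\<close> is the word of its coordinates in that half-tree.
\<close>

definition vertices :: "(bool \<times> nat list) set" where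
  "vertices = UNIV \<times> lists {1..4}"

definition child :: "bool \<times> nat list \<Rightarrow> nat \<Rightarrow> bool \<times> nat list" where
  "child x i = (fst x, snd x @ [i])"

definition adjacent :: "bool \<times> nat list \<Rightarrow> bool \<times> nat list \<Rightarrow> bool" where
  "adjacent x y \<longleftrightarrow> (\<exists>i. y = child x i) \<or> (\<exists>i. x = child y i) \<or>
     (fst x \<noteq> fst y \<and> snd x = [] \<and> snd y = [])"

text \<open>
  The two classes of the bipartition: the endpoints of the distinguished edge have different parity.
\<close>

definition parity :: "bool \<times> nat list \<Rightarrow> bool" where
  "parity x \<longleftrightarrow> (even (length (snd x)) \<longleftrightarrow> fst x)"

definition cone_at :: "bool \<times> nat list \<Rightarrow> (bool \<times> nat list) set" where
  "cone_at x = {(fst x, snd x @ u) | u. u \<in> lists {1..4}}"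

lemma vertices_iff [simp]: "(b, w) \<in> vertices \<longleftrightarrow> w \<in> lists {1..4}"
  by (auto simp: vertices_def)

lemma child_in_vertices [simp]: "child x i \<in> vertices \<longleftrightarrow> x \<in> vertices \<and> i \<in> {1..4}"
  by (cases x) (auto simp: child_def)

lemma child_eq_iff [simp]: "child x i = child y j \<longleftrightarrow> x = y \<and> i = j"
  by (auto simp: child_def prod_eq_iff)

lemma child_neq_root [simp]: "child x i \<noteq> (b, [])" "(b, []) \<noteq> child x i"
  by (auto simp: child_def)

lemma vertex_induct [consumes 1, case_names root child]:
  assumes "x \<in> vertices"
    and "\<And>b. P (b, [])"
    and "\<And>x i. x \<in> vertices \<Longrightarrow> i \<in> {1..4} \<Longrightarrow> P x \<Longrightarrow> P (child x i)"
  shows "P x"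
proof (cases x)
  case (Pair b w)
  have "w \<in> lists {1..4} \<Longrightarrow> P (b, w)"
  proof (induction w rule: rev_induct)
    case (snoc i w)
    then show ?case using assms(3)[of "(b, w)" i] by (simp add: child_def)
  qed (simp add: assms(2))
  then show ?thesis using assms(1) Pair by simp
qed

lemma adjacent_sym: "adjacent x y \<longleftrightarrow> adjacent y x"
  by (auto simp: adjacent_def)

lemma adjacent_child [simp]: "adjacent x (child x i)" "adjacent (child x i) x"
  by (auto simp: adjacent_def)

lemma cone_subset_vertices: "x \<in> vertices \<Longrightarrow> cone_at x \<subseteq> vertices"
  by (cases x) (auto simp: cone_at_def)

lemma cone_child: "y \<in> cone_at x \<Longrightarrow> i \<in> {1..4} \<Longrightarrow> child y i \<in> cone_at x"
  by (auto simp: cone_at_def child_def)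

lemma cone_induct [consumes 1, case_names apex child]:
  assumes "y \<in> cone_at x"
    and "P x"
    and "\<And>y i. y \<in> cone_at x \<Longrightarrow> i \<in> {1..4} \<Longrightarrow> P y \<Longrightarrow> P (child y i)"
  shows "P y"
proof -
  obtain u where u: "u \<in> lists {1..4}" "y = (fst x, snd x @ u)"
    using assms(1) by (auto simp: cone_at_def)
  have "u \<in> lists {1..4} \<Longrightarrow> P (fst x, snd x @ u)"
  proof (induction u rule: rev_induct)
    case (snoc i u)
    then show ?case using assms(3)[of "(fst x, snd x @ u)" i]
      by (auto simp: child_def cone_at_def)
  qed (simp add: assms(2))
  then show ?thesis using u by simp
qed

text \<open>
  The cone below a child of \<open>x\<close> is a component of the tree without \<open>x\<close>.
\<close>

lemma cone_child_boundary:
  assumes "y \<in> cone_at (child x i)" "adjacent y z" "z \<in> vertices" "z \<noteq> x"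
  shows "z \<in> cone_at (child x i)"
proof -
  obtain u where u: "u \<in> lists {1..4}" "y = (fst x, snd x @ i # u)"
    using assms(1) by (auto simp: cone_at_def child_def)
  consider j where "z = child y j" | j where "y = child z j"
    using assms(2) u by (auto simp: adjacent_def)
  then show ?thesis
  proof cases
    case 1
    then show ?thesis using assms(1,3) by (auto intro: cone_child)
  next
    case 2
    show ?thesis
    proof (cases u rule: rev_cases)
      case Nil
      then show ?thesis using 2 u assms(4) by (auto simp: child_def prod_eq_iff)
    next
      case (snoc u' k)
      then have "z = (fst x, snd x @ i # u')"
        using 2 u by (auto simp: child_def prod_eq_iff)
      then show ?thesis using u snoc by (auto simp: cone_at_def child_def)
    qed
  qed
qed

lemma cone_child_unique:
  assumes "y \<in> cone_at (child x i)" "y \<in> cone_at (child x j)" shows "i = j"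
  using assms by (auto simp: cone_at_def child_def)

text \<open>
  The four cones below \<open>x\<close> are components of the tree without \<open>x\<close>, and their images are components of
  the tree without \<open>n x\<close>.  At most one of the cones contains \<open>n x\<close>, and at most one has an image containing
  \<open>x\<close>.  For any other child the image is connected and avoids \<open>x\<close>; if it met the cone, it would lie in
  the cone and so would the neighbour \<open>n x\<close>.
\<close>

lemma moved_cone_disjoint:
  assumes bij: "bij_betw n vertices vertices"
    and adj: "\<And>x y. x \<in> vertices \<Longrightarrow> y \<in> vertices \<Longrightarrow> adjacent x y \<Longrightarrow> adjacent (n x) (n y)"
    and x: "x \<in> vertices" "n x \<noteq> x"
  obtains i where "i \<in> {1..4}" "n ` cone_at (child x i) \<inter> cone_at (child x i) = {}"
proof -
  have mem: "n y \<in> vertices" if "y \<in> vertices" for y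
    using bij that by (auto simp: bij_betw_def)
  have pull: "i = j" if h: "i \<in> {1..4}" "j \<in> {1..4}"
    "x \<in> n ` cone_at (child x i)" "x \<in> n ` cone_at (child x j)" for i j
  proof -
    obtain y z where yz: "y \<in> cone_at (child x i)" "z \<in> cone_at (child x j)" "x = n y" "x = n z"
      using h by blast
    then have "y \<in> vertices" "z \<in> vertices"
      using cone_subset_vertices[of "child x i"] cone_subset_vertices[of "child x j"] x h by auto
    then have "y = z" using yz bij by (metis bij_betw_inv_into_left)
    then show ?thesis using yz cone_child_unique by blast
  qed
  \<comment> \<open>Each of the two obstructions excludes at most one child, so one of three children survives.\<close>
  have "\<exists>i\<in>{1..4}. n x \<notin> cone_at (child x i) \<and> x \<notin> n ` cone_at (child x i)"
  proof (rule ccontr)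
    assume "\<not> ?thesis"
    then have *: "n x \<in> cone_at (child x i) \<or> x \<in> n ` cone_at (child x i)" if "i \<in> {1, 2, 3}" for i
      using that by auto
    have "n x \<in> cone_at (child x i) \<Longrightarrow> n x \<in> cone_at (child x j) \<Longrightarrow> i = j" for i j
      by (rule cone_child_unique)
    note this[of 1 2] this[of 1 3] this[of 2 3] pull[of 1 2] pull[of 1 3] pull[of 2 3]
    then show False
      using *[of 1] *[of 2] *[of 3] by simp blast
  qed
  then obtain i where i: "i \<in> {1..4}" and fwd: "n x \<notin> cone_at (child x i)"
    and bwd: "x \<notin> n ` cone_at (child x i)" by blast
  let ?A = "cone_at (child x i)"
  have sub: "?A \<subseteq> vertices" using cone_subset_vertices[of "child x i"] x i by auto
  \<comment> \<open>An edge joining the inside to the outside of the cone would have to use the vertex \<open>x\<close>.\<close>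
  have out: "n y \<notin> ?A" if "y \<in> ?A" for y
    using that
  proof (induction rule: cone_induct)
    case apex
    show ?case
    proof
      assume "n (child x i) \<in> ?A"
      then have "n x \<in> ?A"
        by (rule cone_child_boundary) (use adj[of "child x i" x] x i mem in auto)
      then show False using fwd by simp
    qed
  next
    case (child y j)
    show ?case
    proof
      assume *: "n (child y j) \<in> ?A"
      have "y \<in> vertices" using child sub by auto
      moreover have "n y \<noteq> x" using bwd child(1) by auto
      ultimately have "n y \<in> ?A"
        using cone_child_boundary[OF *, of "n y"] adj[of "child y j" y] mem child by auto
      then show False using child by simp
    qed
  qed
  with that[OF i] show ?thesis by blast
qed

text \<open>
  The automorphism of the rooted tree whose local action is the same permutation \<open>s j\<close> at all words of
  length \<open>j\<close>.
\<close>

definition levelwise :: "(nat \<Rightarrow> nat \<Rightarrow> nat) \<Rightarrow> nat list \<Rightarrow> nat list" where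
  "levelwise s w = map2 s [0..<length w] w"

lemma levelwise_simps [simp]:
  "levelwise s [] = []" "levelwise s (w @ [i]) = levelwise s w @ [s (length w) i]"
  "length (levelwise s w) = length w"
  by (auto simp: levelwise_def)

lemma levelwise_comp: "levelwise s (levelwise t w) = levelwise (\<lambda>j. s j \<circ> t j) w"
  by (induction w rule: rev_induct) auto

lemma levelwise_id: "(\<And>j. s j = id) \<Longrightarrow> levelwise s w = w"
  by (induction w rule: rev_induct) auto

lemma levelwise_in_lists:
  assumes "\<And>j. s j permutes {1..4}" shows "w \<in> lists {1..4} \<Longrightarrow> levelwise s w \<in> lists {1..4}"
proof (induction w rule: rev_induct)
  case (snoc i w)
  then show ?case using permutes_in_image[OF assms, of "length w" i] by auto
qed simp

lemma levelwise_append: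
  "levelwise s (v @ w) = levelwise s v @ levelwise (\<lambda>j. s (length v + j)) w"
  by (induction w rule: rev_induct) (auto simp flip: append_assoc)

section \<open>Automorphisms with local action in the Klein group\<close>

text \<open>
  The product of two copies of the wreath branch group of the Klein group, described by the local
  condition at each vertex instead of by a projective limit.  Maps are only constrained on
  \<^const>\<open>vertices\<close>, so that formulas like \<open>1 # w\<close> need no case distinction for
  words with other letters.
\<close>

definition branch_group :: "(bool \<times> nat list \<Rightarrow> bool \<times> nat list) set" where
  "branch_group = {u. bij_betw u vertices vertices \<and> (\<forall>b. u (b, []) = (b, [])) \<and>
     (\<forall>x\<in>vertices. \<exists>f\<in>klein_four. \<forall>i\<in>{1..4}. u (child x i) = child (u x) (f i))}"

definition inverse_pair ::
    "(bool \<times> nat list \<Rightarrow> bool \<times> nat list) \<Rightarrow> (bool \<times> nat list \<Rightarrow> bool \<times> nat list) \<Rightarrow> bool" where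
  "inverse_pair m m' \<longleftrightarrow>
     (\<forall>x\<in>vertices. m x \<in> vertices \<and> m' x \<in> vertices \<and> m' (m x) = x \<and> m (m' x) = x)"

definition model_aut :: "(bool \<times> nat list \<Rightarrow> bool \<times> nat list) \<Rightarrow> bool" where
  "model_aut m \<longleftrightarrow> bij_betw m vertices vertices \<and>
     (\<forall>x\<in>vertices. \<forall>y\<in>vertices. adjacent (m x) (m y) \<longleftrightarrow> adjacent x y) \<and>
     (\<forall>x\<in>vertices. parity (m x) = parity x)"

lemma inverse_pair_sym: "inverse_pair m m' \<Longrightarrow> inverse_pair m' m"
  by (auto simp: inverse_pair_def)

lemma inverse_pair_bij: "inverse_pair m m' \<Longrightarrow> bij_betw m vertices vertices"
  by (rule bij_betw_byWitness[of _ m']) (auto simp: inverse_pair_def)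

lemma inverse_pair_comp:
  "inverse_pair m m' \<Longrightarrow> inverse_pair k k' \<Longrightarrow> inverse_pair (m \<circ> k) (k' \<circ> m')"
  by (simp add: inverse_pair_def)

lemma inverse_pair_inv_into:
  "bij_betw m vertices vertices \<Longrightarrow> inverse_pair m (inv_into vertices m)"
  by (auto simp: inverse_pair_def bij_betw_inv_into_left bij_betw_inv_into_right bij_betwE
      inv_into_into bij_betw_imp_surj_on)

text \<open>
  Preservation of adjacency, reduced to the distinguished edge and the edges from a vertex to a child.
\<close>

definition edge_map :: "(bool \<times> nat list \<Rightarrow> bool \<times> nat list) \<Rightarrow> bool" where
  "edge_map m \<longleftrightarrow> adjacent (m (True, [])) (m (False, [])) \<and>
     (\<forall>x\<in>vertices. \<forall>i\<in>{1..4}. adjacent (m x) (m (child x i)))"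

lemma edge_map_adjacent:
  assumes "edge_map m" "x \<in> vertices" "y \<in> vertices" "adjacent x y" shows "adjacent (m x) (m y)"
proof -
  consider i where "y = child x i" | i where "x = child y i"
    | "fst x \<noteq> fst y" "snd x = []" "snd y = []"
    using assms(4) by (auto simp: adjacent_def)
  then show ?thesis
  proof cases
    case 3
    then have "(x = (True, []) \<and> y = (False, [])) \<or> (x = (False, []) \<and> y = (True, []))"
      by (cases x; cases y) auto
    then show ?thesis using assms(1) adjacent_sym unfolding edge_map_def by blast
  qed (use assms adjacent_sym in \<open>auto simp: edge_map_def\<close>)
qed

text \<open>
  Adjacency is reflected by \<open>m\<close> because it is preserved by \<open>m'\<close>.
\<close>

lemma model_autI:
  assumes pair: "inverse_pair m m'" and edge_map: "edge_map m" "edge_map m'"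
    and parity: "\<And>x. x \<in> vertices \<Longrightarrow> parity (m x) = parity x"
  shows "model_aut m"
proof -
  have "adjacent (m x) (m y) \<longleftrightarrow> adjacent x y" if xy: "x \<in> vertices" "y \<in> vertices" for x y
  proof
    assume "adjacent (m x) (m y)"
    then have "adjacent (m' (m x)) (m' (m y))"
      using edge_map_adjacent[OF edge_map(2), of "m x" "m y"] pair xy
      by (simp add: inverse_pair_def)
    then show "adjacent x y" using pair xy by (auto simp: inverse_pair_def)
  qed (use edge_map_adjacent[OF edge_map(1)] xy in auto)
  then show ?thesis
    using inverse_pair_bij[OF pair] parity by (auto simp: model_aut_def)
qed

lemma branch_group_mem: "u \<in> branch_group \<Longrightarrow> x \<in> vertices \<Longrightarrow> u x \<in> vertices"
  by (auto simp: branch_group_def bij_betw_def)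

lemma branch_group_root: "u \<in> branch_group \<Longrightarrow> u (b, []) = (b, [])"
  by (auto simp: branch_group_def)

lemma branch_group_child:
  assumes "u \<in> branch_group" "x \<in> vertices"
  obtains f where "f \<in> klein_four" "\<And>i. i \<in> {1..4} \<Longrightarrow> u (child x i) = child (u x) (f i)"
  using assms by (auto simp: branch_group_def)

lemma branch_group_level:
  assumes "u \<in> branch_group" "x \<in> vertices"
  shows "fst (u x) = fst x \<and> length (snd (u x)) = length (snd x)"
  using assms(2)
proof (induction rule: vertex_induct)
  case (root b)
  then show ?case using branch_group_root[OF assms(1)] by simp
next
  case (child x i)
  then show ?case using branch_group_child[OF assms(1) child(1)]
    by (metis child_def fst_conv length_append_singleton snd_conv)
qed

lemma branch_group_id: "id \<in> branch_group"
  using klein_four_id by (auto simp: branch_group_def bij_betw_def intro!: bexI[of _ id])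

lemma branch_group_comp:
  assumes u: "u \<in> branch_group" and v: "v \<in> branch_group" shows "u \<circ> v \<in> branch_group"
proof -
  have "\<exists>h\<in>klein_four. \<forall>i\<in>{1..4}. (u \<circ> v) (child x i) = child ((u \<circ> v) x) (h i)"
    if x: "x \<in> vertices" for x
  proof -
    obtain f where f: "f \<in> klein_four" "\<And>i. i \<in> {1..4} \<Longrightarrow> v (child x i) = child (v x) (f i)"
      using branch_group_child[OF v x] by metis
    obtain g where g: "g \<in> klein_four" "\<And>i. i \<in> {1..4} \<Longrightarrow> u (child (v x) i) = child (u (v x)) (g i)"
      using branch_group_child[OF u branch_group_mem[OF v x]] by metis
    have "f i \<in> {1..4}" if "i \<in> {1..4}" for i
      using permutes_in_image[OF klein_four_permutes[OF f(1)]] that by blast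
    then show ?thesis using f g klein_four_comp[OF g(1) f(1)] by (intro bexI[of _ "g \<circ> f"]) auto
  qed
  then show ?thesis using u v bij_betw_trans[of v vertices vertices u vertices]
    by (auto simp: branch_group_def)
qed

text \<open>
  At \<open>u' x\<close> the local action of \<open>u\<close> is an involution, hence it is also the local action of \<open>u'\<close> at \<open>x\<close>.
\<close>

lemma branch_group_inverse:
  assumes u: "u \<in> branch_group" and pair: "inverse_pair u u'" shows "u' \<in> branch_group"
proof -
  have "u' (b, []) = (b, [])" for b
  proof -
    have "(b, []) \<in> vertices" by simp
    then have "u' (u (b, [])) = (b, [])" using pair unfolding inverse_pair_def by blast
    then show ?thesis using branch_group_root[OF u, of b] by simp
  qed
  moreover have "\<exists>f\<in>klein_four. \<forall>i\<in>{1..4}. u' (child x i) = child (u' x) (f i)"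
    if x: "x \<in> vertices" for x
  proof -
    have y: "u' x \<in> vertices" "u (u' x) = x" using pair x by (auto simp: inverse_pair_def)
    obtain f where f: "f \<in> klein_four"
        "\<And>i. i \<in> {1..4} \<Longrightarrow> u (child (u' x) i) = child (u (u' x)) (f i)"
      using branch_group_child[OF u y(1)] by metis
    have "u' (child x i) = child (u' x) (f i)" if i: "i \<in> {1..4}" for i
    proof -
      have fi: "f i \<in> {1..4}" using permutes_in_image[OF klein_four_permutes[OF f(1)]] i by blast
      have "u (child (u' x) (f i)) = child x i"
        using f(2)[OF fi] y(2) klein_four_involution[OF f(1)] by simp
      moreover have "child (u' x) (f i) \<in> vertices" using y fi by simp
      ultimately show ?thesis using pair unfolding inverse_pair_def by metis
    qed
    then show ?thesis using f(1) by blast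
  qed
  ultimately show ?thesis
    using inverse_pair_bij[OF inverse_pair_sym[OF pair]] by (auto simp: branch_group_def)
qed

lemma branch_group_inv_into:
  assumes "u \<in> branch_group"
  shows "inverse_pair u (inv_into vertices u)" "inv_into vertices u \<in> branch_group"
proof -
  show "inverse_pair u (inv_into vertices u)"
    using assms by (intro inverse_pair_inv_into) (auto simp: branch_group_def)
  then show "inv_into vertices u \<in> branch_group" by (rule branch_group_inverse[OF assms])
qed

lemma branch_group_edge_map: assumes "u \<in> branch_group" shows "edge_map u"
proof -
  have "adjacent (u x) (u (child x i))" if "x \<in> vertices" "i \<in> {1..4}" for x i
    using branch_group_child[OF assms that(1)] that(2) adjacent_child by metis
  then show ?thesis using branch_group_root[OF assms] by (auto simp: edge_map_def adjacent_def)
qed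

lemma branch_group_model_aut:
  assumes "u \<in> branch_group" shows "model_aut u"
  by (rule model_autI[OF branch_group_inv_into(1)[OF assms]])
    (use assms branch_group_edge_map branch_group_inv_into branch_group_level in
      \<open>auto simp: parity_def\<close>)

lemma branch_group_cone:
  assumes u: "u \<in> branch_group" and vw: "v \<in> lists {1..4}" "w \<in> lists {1..4}"
  shows "\<exists>w'. w' \<in> lists {1..4} \<and> length w' = length w \<and>
    u (b, v @ w) = (b, snd (u (b, v)) @ w')"
  using vw(2)
proof (induction w rule: rev_induct)
  case Nil
  then show ?case using branch_group_level[OF u, of "(b, v)"] vw(1) by (auto simp: prod_eq_iff)
next
  case (snoc i w)
  then obtain w' where w': "w' \<in> lists {1..4}" "length w' = length w"
      "u (b, v @ w) = (b, snd (u (b, v)) @ w')" by auto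
  have i: "i \<in> {1..4}" and x: "(b, v @ w) \<in> vertices" using snoc vw by auto
  obtain f where f: "f \<in> klein_four"
      "\<And>i. i \<in> {1..4} \<Longrightarrow> u (child (b, v @ w) i) = child (u (b, v @ w)) (f i)"
    using branch_group_child[OF u x] by metis
  have "f i \<in> {1..4}" using permutes_in_image[OF klein_four_permutes[OF f(1)]] i by blast
  then show ?case
    using f(2)[OF i] w' by (intro exI[of _ "w' @ [f i]"]) (auto simp: child_def)
qed

definition fixes_ball :: "nat \<Rightarrow> (bool \<times> nat list \<Rightarrow> bool \<times> nat list) \<Rightarrow> bool" where
  "fixes_ball k u \<longleftrightarrow> (\<forall>x\<in>vertices. length (snd x) \<le> k \<longrightarrow> u x = x)"

text \<open>
  Conjugation by \<open>m\<close> and by its inverse carries a ball stabilizer of the branch group into the branch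
  group.  As ball stabilizers have finite index, such an \<open>m\<close> commensurates the branch group.
\<close>

definition commensurating ::
  "(bool \<times> nat list \<Rightarrow> bool \<times> nat list) \<Rightarrow> (bool \<times> nat list \<Rightarrow> bool \<times> nat list) \<Rightarrow> bool" where
  "commensurating m m' \<longleftrightarrow> (\<exists>k. \<forall>u\<in>branch_group. fixes_ball k u \<longrightarrow>
     m \<circ> u \<circ> m' \<in> branch_group \<and> m' \<circ> u \<circ> m \<in> branch_group)"

lemma branch_groupI:
  assumes "inverse_pair u u'" "\<And>b. u (b, []) = (b, [])"
    and "\<And>x. x \<in> vertices \<Longrightarrow> \<exists>f\<in>klein_four. \<forall>i\<in>{1..4}. u (child x i) = child (u x) (f i)"
  shows "u \<in> branch_group"
  using assms inverse_pair_bij by (auto simp: branch_group_def)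

definition levelwise_aut :: "(nat \<Rightarrow> nat \<Rightarrow> nat) \<Rightarrow> bool \<times> nat list \<Rightarrow> bool \<times> nat list" where
  "levelwise_aut s x = (fst x, levelwise s (snd x))"

lemma levelwise_aut_in_branch_group:
  assumes s: "\<And>j. s j \<in> klein_four" shows "levelwise_aut s \<in> branch_group"
proof (rule branch_groupI[of _ "levelwise_aut s"])
  have p: "s j permutes {1..4}" for j using klein_four_permutes[OF s] .
  have "levelwise s (levelwise s w) = w" for w
    unfolding levelwise_comp by (rule levelwise_id) (use s klein_four_involution in \<open>auto simp: fun_eq_iff\<close>)
  then show "inverse_pair (levelwise_aut s) (levelwise_aut s)"
    using levelwise_in_lists[of s, OF p]
    by (auto simp: inverse_pair_def levelwise_aut_def simp del: in_lists_conv_set)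
  show "\<exists>f\<in>klein_four. \<forall>i\<in>{1..4}. levelwise_aut s (child x i) = child (levelwise_aut s x) (f i)"
    for x using s by (intro bexI[of _ "s (length (snd x))"]) (auto simp: levelwise_aut_def child_def)
qed (auto simp: levelwise_aut_def)

section \<open>Shifts along an axis and twists on a cone\<close>

text \<open>
  Translation by one step towards side \<open>b\<close>, along the axis through the vertices whose words consist
  of ones only.  It replaces prefixes of words and therefore leaves the local coordinates unchanged at
  every vertex other than \<open>(\<not> b, [])\<close>.
\<close>

definition shift :: "bool \<Rightarrow> bool \<times> nat list \<Rightarrow> bool \<times> nat list" where
  "shift b x = (if fst x = b then (b, 1 # snd x)
     else case snd x of [] \<Rightarrow> (b, []) | i # w \<Rightarrow> if i = 1 then (\<not> b, w) else (b, i # w))"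

lemma shift_inverse [simp]: "shift (\<not> b) (shift b x) = x" "shift b (shift (\<not> b) x) = x"
  by (auto simp: shift_def prod_eq_iff split: list.splits)

lemma shift_pair: "inverse_pair (shift b) (shift (\<not> b))"
  unfolding inverse_pair_def
  by (auto simp: vertices_def) (auto simp: shift_def split: list.splits if_splits)

lemma shift_child:
  assumes "x \<noteq> (\<not> b, [])" shows "shift b (child x i) = child (shift b x) i"
  using assms by (auto simp: shift_def child_def prod_eq_iff split: list.splits)

lemma shift_child_root: "shift b (child (\<not> b, []) i) = (if i = 1 then (\<not> b, []) else (b, [i]))"
  by (auto simp: shift_def child_def)

lemma shift_root: "shift b (\<not> b, []) = (b, [])" "shift b (b, []) = (b, [1])"
  by (auto simp: shift_def)

lemma shift_edge_map: "edge_map (shift b)"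
proof -
  have "adjacent (shift b x) (shift b (child x i))" for x i
  proof (cases "x = (\<not> b, [])")
    case True
    have "shift b (child x i) = (\<not> b, []) \<or> shift b (child x i) = child (b, []) i"
      unfolding True shift_child_root by (simp add: child_def)
    moreover have "shift b x = (b, [])" using True shift_root by simp
    ultimately show ?thesis by (auto simp: adjacent_def)
  qed (simp add: shift_child)
  moreover have "adjacent (shift b (True, [])) (shift b (False, []))"
    by (cases b) (auto simp: shift_def adjacent_def child_def)
  ultimately show ?thesis by (auto simp: edge_map_def)
qed

lemma shift_parity: "parity (shift b x) \<longleftrightarrow> \<not> parity x"
  by (cases x) (auto simp: shift_def parity_def split: list.splits)

lemma shift_length: "length (snd (shift b x)) \<le> Suc (length (snd x))"
  by (auto simp: shift_def split: list.splits)

text \<open>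
  A shift respects the numbering of children except at one vertex, where the distinguished edge changes
  its role.  An element fixing the ball of radius one acts trivially around that vertex, so its conjugate
  has the same local actions, transported by the shift.
\<close>

lemma shift_conj_branch_group:
  assumes u: "u \<in> branch_group" and ball: "fixes_ball (Suc k) u"
  shows "shift b \<circ> u \<circ> shift (\<not> b) \<in> branch_group" (is "?mem")
    and "fixes_ball k (shift b \<circ> u \<circ> shift (\<not> b))" (is "?ball")
proof -
  let ?v = "shift b \<circ> u \<circ> shift (\<not> b)"
  have fixed: "u x = x" if "x \<in> vertices" "length (snd x) \<le> Suc k" for x
    using ball that by (auto simp: fixes_ball_def)
  have stays: "shift (\<not> b) x \<in> vertices" if "x \<in> vertices" for x
    using shift_pair[of b] that by (auto simp: inverse_pair_def)
  show fixed_ball: "?ball"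
    unfolding fixes_ball_def
  proof (intro ballI impI)
    fix x assume x: "x \<in> vertices" "length (snd x) \<le> k"
    then have "u (shift (\<not> b) x) = shift (\<not> b) x"
      using shift_length[of "\<not> b" x] stays by (intro fixed) auto
    then show "?v x = x" by simp
  qed
  show "?mem"
  proof (rule branch_groupI)
    show "inverse_pair ?v (shift b \<circ> inv_into vertices u \<circ> shift (\<not> b))"
      using inverse_pair_comp[OF inverse_pair_comp[OF shift_pair branch_group_inv_into(1)[OF u]]
          shift_pair[of "\<not> b"], of b]
      by (simp add: comp_assoc)
    show "?v (c, []) = (c, [])" for c using fixed_ball by (auto simp: fixes_ball_def)
    show "\<exists>f\<in>klein_four. \<forall>i\<in>{1..4}. ?v (child x i) = child (?v x) (f i)"
      if x: "x \<in> vertices" for x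
    \<comment> \<open>The vertex \<open>(b, [])\<close> is the image of the exceptional one; the conjugate fixes its children.\<close>
    proof (cases "x = (b, [])")
      case True
      have "?v (child x i) = child (?v x) (id i)" if "i \<in> {1..4}" for i
      proof -
        have "u (shift (\<not> b) (child x i)) = shift (\<not> b) (child x i)"
          using that True shift_child_root[of "\<not> b" i] by (intro fixed stays) auto
        moreover have "?v x = x" using fixed_ball True by (auto simp: fixes_ball_def)
        ultimately show ?thesis by simp
      qed
      then show ?thesis using klein_four_id by blast
    next
      case False
      let ?y = "shift (\<not> b) x"
      have y: "?y \<in> vertices" using stays[OF x] .
      obtain f where f: "f \<in> klein_four" "\<And>i. i \<in> {1..4} \<Longrightarrow> u (child ?y i) = child (u ?y) (f i)"
        using branch_group_child[OF u y] by metis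
      have "?y \<noteq> (\<not> b, [])" using False shift_inverse(2)[of b x] shift_root by metis
      then have "u ?y \<noteq> (\<not> b, [])"
        using branch_group_level[OF u y] by (auto simp: prod_eq_iff)
      then have "?v (child x i) = child (?v x) (f i)" if "i \<in> {1..4}" for i
        using f(2)[OF that] False by (simp add: shift_child)
      then show ?thesis using f(1) by blast
    qed
  qed
qed

text \<open>
  A single shift exchanges the two types of vertices; its square is type-preserving.
\<close>

definition double_shift :: "bool \<Rightarrow> bool \<times> nat list \<Rightarrow> bool \<times> nat list" where
  "double_shift b = shift b \<circ> shift b"

lemma double_shift_pair: "inverse_pair (double_shift b) (double_shift (\<not> b))"
  unfolding double_shift_def by (rule inverse_pair_comp[OF shift_pair shift_pair])

lemma double_shift_edge_map: "edge_map (double_shift b)"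
proof -
  have mem: "shift b x \<in> vertices" if "x \<in> vertices" for x
    using shift_pair[of b] that by (simp add: inverse_pair_def)
  have "adjacent (shift b (shift b x)) (shift b (shift b y))"
    if "x \<in> vertices" "y \<in> vertices" "adjacent x y" for x y
    by (rule edge_map_adjacent[OF shift_edge_map mem mem
          edge_map_adjacent[OF shift_edge_map]]) (use that in simp_all)
  moreover have "adjacent (True, []) (False, [])" by (simp add: adjacent_def)
  ultimately show ?thesis unfolding edge_map_def double_shift_def by auto
qed

lemma double_shift_model_aut: "model_aut (double_shift b)"
proof (rule model_autI[OF double_shift_pair])
  show "parity (double_shift b x) = parity x" for x
    by (simp add: double_shift_def shift_parity)
qed (rule double_shift_edge_map)+

lemma double_shift_commensurating: "commensurating (double_shift b) (double_shift (\<not> b))"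
  unfolding commensurating_def
proof (intro exI ballI impI conjI)
  fix u assume u: "u \<in> branch_group" "fixes_ball (Suc (Suc 0)) u"
  show "double_shift b \<circ> u \<circ> double_shift (\<not> b) \<in> branch_group"
    using shift_conj_branch_group(1)[OF shift_conj_branch_group[OF u, of b], of b]
    by (simp add: double_shift_def comp_assoc)
  show "double_shift (\<not> b) \<circ> u \<circ> double_shift b \<in> branch_group"
    using shift_conj_branch_group(1)[OF shift_conj_branch_group[OF u, of "\<not> b"], of "\<not> b"]
    by (simp add: double_shift_def comp_assoc)
qed

text \<open>
  The levelwise automorphism acting on the cone below \<open>(True, [2])\<close>, extended by the identity.  The cone
  branches off the axis of the shifts at \<open>(True, [])\<close>, so powers of the shifts carry it arbitrarily deep into either side.
\<close>

definition cone_twist :: "(nat \<Rightarrow> nat \<Rightarrow> nat) \<Rightarrow> bool \<times> nat list \<Rightarrow> bool \<times> nat list" where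
  "cone_twist s x = (if x \<in> cone_at (True, [2])
     then (True, 2 # levelwise s (tl (snd x))) else x)"

lemma cone_twist_simps:
  "w \<in> lists {1..4} \<Longrightarrow> cone_twist s (True, 2 # w) = (True, 2 # levelwise s w)"
  "x \<notin> cone_at (True, [2]) \<Longrightarrow> cone_twist s x = x"
  by (auto simp: cone_twist_def cone_at_def)

lemma cone_twist_cone:
  assumes "\<And>j. s j permutes {1..4}" "x \<in> cone_at (True, [2])"
  shows "cone_twist s x \<in> cone_at (True, [2])"
  using assms levelwise_in_lists[of s] by (auto simp: cone_twist_simps cone_at_def)

lemma cone_twist_comp:
  assumes "\<And>j. t j permutes {1..4}"
  shows "cone_twist s \<circ> cone_twist t = cone_twist (\<lambda>j. s j \<circ> t j)"
proof
  fix x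
  show "(cone_twist s \<circ> cone_twist t) x = cone_twist (\<lambda>j. s j \<circ> t j) x"
  proof (cases "x \<in> cone_at (True, [2])")
    case True
    then obtain w where w: "w \<in> lists {1..4}" "x = (True, 2 # w)" by (auto simp: cone_at_def)
    then show ?thesis
      using levelwise_in_lists[of t, OF assms w(1)] by (simp add: cone_twist_simps levelwise_comp)
  qed (simp add: cone_twist_simps)
qed

lemma cone_twist_id: "(\<And>j. s j = id) \<Longrightarrow> cone_twist s = id"
  by (auto simp: fun_eq_iff cone_twist_def cone_at_def levelwise_id)

lemma cone_twist_pair:
  assumes s: "\<And>j. s j permutes {1..4}"
  shows "inverse_pair (cone_twist s) (cone_twist (\<lambda>j. inv_into UNIV (s j)))"
proof -
  let ?s' = "\<lambda>j. inv_into UNIV (s j)"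
  have s': "?s' j permutes {1..4}" for j using permutes_inv[OF s] .
  have "cone_twist s \<circ> cone_twist ?s' = id" "cone_twist ?s' \<circ> cone_twist s = id"
    unfolding cone_twist_comp[of s, OF s] cone_twist_comp[of ?s', OF s']
    using permutes_inv_o[OF s] by (auto intro!: cone_twist_id)
  moreover have "cone_twist t x \<in> vertices" if "\<And>j. t j permutes {1..4}" "x \<in> vertices" for t x
    using cone_twist_cone[of t x] cone_subset_vertices[of "(True, [2])"] that
    by (cases "x \<in> cone_at (True, [2])") (auto simp: cone_twist_simps)
  ultimately show ?thesis using s s' by (auto simp: inverse_pair_def fun_eq_iff)
qed

lemma cone_twist_child:
  assumes "x \<in> cone_at (True, [2])" "i \<in> {1..4}"
  shows "cone_twist s (child x i) = child (cone_twist s x) (s (length (snd x) - 1) i)"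
proof -
  obtain w where w: "w \<in> lists {1..4}" "x = (True, 2 # w)" using assms by (auto simp: cone_at_def)
  then have "child x i = (True, 2 # (w @ [i]))" "w @ [i] \<in> lists {1..4}"
    using assms by (auto simp: child_def)
  then show ?thesis using w by (auto simp: cone_twist_simps child_def)
qed

lemma cone_twist_outside_child:
  assumes "x \<notin> cone_at (True, [2])"
  shows "cone_twist s (child x i) = child x i"
proof (cases "child x i \<in> cone_at (True, [2])")
  case True
  then obtain w where w: "w \<in> lists {1..4}" "child x i = (True, 2 # w)" by (auto simp: cone_at_def)
  show ?thesis
  proof (cases w rule: rev_cases)
    case Nil
    then show ?thesis using w by (simp add: cone_twist_simps)
  next
    case (snoc w' k)
    then have "x \<in> cone_at (True, [2])" using w by (auto simp: child_def cone_at_def prod_eq_iff)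
    then show ?thesis using assms by simp
  qed
qed (simp add: cone_twist_simps)

lemma cone_twist_edge_map:
  assumes "\<And>j. s j permutes {1..4}" shows "edge_map (cone_twist s)"
proof -
  have "adjacent (cone_twist s x) (cone_twist s (child x i))" if "i \<in> {1..4}" for x i
    using that by (cases "x \<in> cone_at (True, [2])")
      (simp_all add: cone_twist_child cone_twist_outside_child cone_twist_simps)
  moreover have "(b, []) \<notin> cone_at (True, [2])" for b by (auto simp: cone_at_def)
  ultimately show ?thesis by (auto simp: edge_map_def cone_twist_simps adjacent_def)
qed

lemma cone_twist_level: "fst (cone_twist s x) = fst x \<and> length (snd (cone_twist s x)) = length (snd x)"
  by (auto simp: cone_twist_def cone_at_def)

lemma cone_twist_model_aut:
  assumes s: "\<And>j. s j permutes {1..4}" shows "model_aut (cone_twist s)"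
  by (rule model_autI[OF cone_twist_pair[of s, OF s]])
    (auto simp: parity_def cone_twist_level intro!: cone_twist_edge_map s permutes_inv)

text \<open>
  Elements of the branch group preserve levels, and the local action of the twist depends on the level
  only.  Conjugation therefore changes the local action \<open>f\<close> of \<open>u\<close> at a vertex of the cone to
  \<open>s k \<circ> f \<circ> inv (s k)\<close> with the same \<open>s k\<close> before and after \<open>f\<close>, and this stays in the Klein group.
\<close>

lemma cone_twist_conj_branch_group:
  assumes s: "\<And>j. s j \<in> klein_normalizer"
    and u: "u \<in> branch_group" "fixes_ball 1 u"
  shows "cone_twist s \<circ> u \<circ> cone_twist (\<lambda>j. inv_into UNIV (s j)) \<in> branch_group"
proof -
  let ?s' = "\<lambda>j. inv_into UNIV (s j)" and ?C = "cone_at (True, [2])"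
  let ?v = "cone_twist s \<circ> u \<circ> cone_twist ?s'"
  have p: "s j permutes {1..4}" for j using s by (auto simp: klein_normalizer_def)
  have p': "?s' j permutes {1..4}" for j using permutes_inv[OF p] .
  \<comment> \<open>As \<open>u\<close> fixes the apex of the cone, it preserves the cone and its complement.\<close>
  have keep: "u x \<in> ?C" if h: "x \<in> ?C" for x
  proof -
    obtain w where w: "w \<in> lists {1..4}" "x = (True, [2] @ w)" using h by (auto simp: cone_at_def)
    have "u (True, [2]) = (True, [2])" using u(2) by (simp add: fixes_ball_def)
    then show ?thesis using branch_group_cone[OF u(1), of "[2]" w True] w by (auto simp: cone_at_def)
  qed
  have keep': "u x \<notin> ?C" if "x \<notin> ?C" "x \<in> vertices" for x
  proof
    assume "u x \<in> ?C"
    then obtain w where w: "w \<in> lists {1..4}" "u x = (True, [2] @ w)" by (auto simp: cone_at_def)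
    let ?u' = "inv_into vertices u"
    have u': "?u' \<in> branch_group" "inverse_pair u ?u'" using branch_group_inv_into[OF u(1)] by auto
    have "u (True, [2]) = (True, [2])" using u(2) by (simp add: fixes_ball_def)
    moreover have "(True, [2]) \<in> vertices" by simp
    then have "?u' (u (True, [2])) = (True, [2])" using u'(2) unfolding inverse_pair_def by blast
    ultimately have "?u' (True, [2]) = (True, [2])" by simp
    then have "?u' (u x) \<in> ?C"
      using branch_group_cone[OF u'(1), of "[2]" w True] w by (auto simp: cone_at_def)
    moreover have "?u' (u x) = x" using u'(2) that(2) by (simp add: inverse_pair_def)
    ultimately show False using that by simp
  qed
  show ?thesis
  proof (rule branch_groupI)
    have "inverse_pair (cone_twist s \<circ> u \<circ> cone_twist ?s')
        (cone_twist s \<circ> (inv_into vertices u \<circ> cone_twist ?s'))"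
      by (intro inverse_pair_comp branch_group_inv_into u inverse_pair_sym[OF cone_twist_pair]
          cone_twist_pair p)
    then show "inverse_pair ?v (cone_twist s \<circ> (inv_into vertices u \<circ> cone_twist ?s'))" .
    show "?v (b, []) = (b, [])" for b
    proof -
      have "(b, []) \<notin> ?C" by (auto simp: cone_at_def)
      then show ?thesis using branch_group_root[OF u(1)] by (simp add: cone_twist_simps)
    qed
    show "\<exists>f\<in>klein_four. \<forall>i\<in>{1..4}. ?v (child x i) = child (?v x) (f i)"
      if x: "x \<in> vertices" for x
    proof (cases "x \<in> ?C")
      case False
      obtain f where f: "f \<in> klein_four" "\<And>i. i \<in> {1..4} \<Longrightarrow> u (child x i) = child (u x) (f i)"
        using branch_group_child[OF u(1) x] by metis
      then show ?thesis using keep'[OF False x] False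
        by (auto simp: cone_twist_simps cone_twist_outside_child)
    next
      case True
      let ?y = "cone_twist ?s' x" and ?k = "length (snd x) - 1"
      have y: "?y \<in> ?C" by (rule cone_twist_cone[OF p' True])
      have yv: "?y \<in> vertices" using y cone_subset_vertices[of "(True, [2])"] by auto
      obtain f where f: "f \<in> klein_four" "\<And>i. i \<in> {1..4} \<Longrightarrow> u (child ?y i) = child (u ?y) (f i)"
        using branch_group_child[OF u(1) yv] by metis
      have fp: "f permutes {1..4}" using klein_four_permutes[OF f(1)] .
      have len: "length (snd (u ?y)) - 1 = ?k"
        using branch_group_level[OF u(1) yv] cone_twist_level[of ?s' x] by simp
      have "?v (child x i) = child (?v x) ((s ?k \<circ> f \<circ> ?s' ?k) i)" if i: "i \<in> {1..4}" for i
      proof -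
        have i1: "?s' ?k i \<in> {1..4}" using permutes_in_image[OF p'] i by blast
        then have i2: "f (?s' ?k i) \<in> {1..4}" using permutes_in_image[OF fp] by blast
        show ?thesis
          using cone_twist_child[OF True i, of ?s'] f(2)[OF i1] cone_twist_child[OF keep[OF y] i2, of s] len
          by simp
      qed
      moreover have "s ?k \<circ> f \<circ> ?s' ?k \<in> klein_four"
        using s[of ?k] f(1) by (auto simp: klein_normalizer_def)
      ultimately show ?thesis by blast
    qed
  qed
qed

lemma cone_twist_commensurating:
  assumes s: "\<And>j. s j \<in> klein_normalizer"
  shows "commensurating (cone_twist s) (cone_twist (\<lambda>j. inv_into UNIV (s j)))"
  unfolding commensurating_def
proof (intro exI ballI impI conjI)
  have p: "s j permutes {1..4}" for j using s by (auto simp: klein_normalizer_def)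
  fix u assume u: "u \<in> branch_group" "fixes_ball 1 u"
  show "cone_twist s \<circ> u \<circ> cone_twist (\<lambda>j. inv_into UNIV (s j)) \<in> branch_group"
    by (rule cone_twist_conj_branch_group[OF s u])
  show "cone_twist (\<lambda>j. inv_into UNIV (s j)) \<circ> u \<circ> cone_twist s \<in> branch_group"
    using cone_twist_conj_branch_group[OF klein_normalizer_inv[OF s] u]
    by (simp add: permutes_inv_inv[OF p])
qed

section \<open>The commensurator\<close>

lemma carrier_perm_group [simp]: "carrier (perm_group S) = S"
  and mult_perm_group [simp]: "x \<otimes>\<^bsub>perm_group S\<^esub> y = x \<circ> y"
  and one_perm_group [simp]: "\<one>\<^bsub>perm_group S\<^esub> = id"
  by (simp_all add: perm_group_def)

text \<open>
  The description operator in \<^const>\<open>m_inv\<close> has a unique solution because inverse functions are unique.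
\<close>

lemma m_inv_perm_group:
  assumes "g \<in> S" "g' \<in> S" "g \<circ> g' = id" "g' \<circ> g = id"
  shows "inv\<^bsub>perm_group S\<^esub> g = g'"
  unfolding m_inv_def
proof (rule the_equality)
  fix y assume "y \<in> carrier (perm_group S) \<and> g \<otimes>\<^bsub>perm_group S\<^esub> y = \<one>\<^bsub>perm_group S\<^esub> \<and>
     y \<otimes>\<^bsub>perm_group S\<^esub> g = \<one>\<^bsub>perm_group S\<^esub>"
  then have "y \<circ> g = id" by simp
  then have "y \<circ> (g \<circ> g') = g'" by (simp add: comp_assoc[symmetric])
  then show "y = g'" using assms by simp
qed (use assms in simp)

text \<open>
  A finite invariant \<open>f\<close> that determines the right coset bounds the number of cosets.
\<close>

lemma finite_index_perm_group:
  assumes H: "\<And>h k. h \<in> H \<Longrightarrow> k \<in> H \<Longrightarrow> h \<circ> k \<in> H"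
    and K: "K = r ` I"
    and fin: "finite (f ` I)"
    and same: "\<And>i j. i \<in> I \<Longrightarrow> j \<in> I \<Longrightarrow> f i = f j \<Longrightarrow> \<exists>k\<in>H. r i = k \<circ> r j"
  shows "finite_index (perm_group S) H K"
proof -
  define coset where "coset i = (\<lambda>h. h \<circ> r i) ` H" for i
  have sub: "coset i \<subseteq> coset j" if ij: "i \<in> I" "j \<in> I" "f i = f j" for i j
  proof -
    obtain k where k: "k \<in> H" "r i = k \<circ> r j" using same[OF ij] by blast
    have "h \<circ> r i = (h \<circ> k) \<circ> r j" if "h \<in> H" for h using k by (simp add: comp_assoc)
    then show ?thesis using H k by (fastforce simp: coset_def)
  qed
  have "coset ` I \<subseteq> (\<lambda>y. coset (SOME i. i \<in> I \<and> f i = y)) ` f ` I"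
  proof
    fix c assume "c \<in> coset ` I"
    then obtain i where i: "i \<in> I" "c = coset i" by blast
    have "(SOME j. j \<in> I \<and> f j = f i) \<in> I \<and> f (SOME j. j \<in> I \<and> f j = f i) = f i"
      by (rule someI[of _ i]) (use i in simp)
    then have "c = coset (SOME j. j \<in> I \<and> f j = f i)"
      using sub i by (metis subset_antisym)
    then show "c \<in> (\<lambda>y. coset (SOME i. i \<in> I \<and> f i = y)) ` f ` I" using i by blast
  qed
  then have "finite (coset ` I)" using fin by (meson finite_imageI finite_subset)
  moreover have "rcosets\<^bsub>perm_group S\<lparr>carrier := K\<rparr>\<^esub> H = coset ` I"
    by (auto simp: RCOSETS_def r_coset_def K coset_def perm_group_def)
  ultimately show ?thesis by (simp add: finite_index_def)
qed

text \<open>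
  Since \<open>u \<circ> inverse v\<close> fixes a ball exactly when the inverses of \<open>u\<close> and \<open>v\<close> agree on it, the restriction of the
  inverse is the invariant of the right cosets of the ball stabilizer.
\<close>

definition ball_restriction ::
    "nat \<Rightarrow> (bool \<times> nat list \<Rightarrow> bool \<times> nat list) \<Rightarrow> bool \<times> nat list \<Rightarrow> bool \<times> nat list" where
  "ball_restriction k u = restrict (inv_into vertices u) {x \<in> vertices. length (snd x) \<le> k}"

lemma finite_ball_restrictions: "finite (ball_restriction k ` branch_group)"
proof -
  let ?B = "{x \<in> vertices. length (snd x) \<le> k}"
  have "?B = UNIV \<times> {w. set w \<subseteq> {1..4} \<and> length w \<le> k}"
    by (auto simp: vertices_def lists_eq_set)
  then have fin: "finite ?B" by (simp add: finite_lists_length_le)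
  have "ball_restriction k u \<in> ?B \<rightarrow>\<^sub>E ?B" if u: "u \<in> branch_group" for u
    using branch_group_inv_into[OF u] branch_group_mem branch_group_level
    by (auto simp: ball_restriction_def)
  then show ?thesis using finite_PiE[OF fin, of "\<lambda>_. ?B"] fin by (meson finite_subset image_subsetI)
qed

lemma ball_restriction_eq:
  assumes u: "u \<in> branch_group" and v: "v \<in> branch_group"
    and eq: "ball_restriction k u = ball_restriction k v"
  obtains w where "w \<in> branch_group" "fixes_ball k w" "\<And>x. x \<in> vertices \<Longrightarrow> u x = w (v x)"
proof
  let ?w = "u \<circ> inv_into vertices v"
  note pu = branch_group_inv_into[OF u] and pv = branch_group_inv_into[OF v]
  show "?w \<in> branch_group" by (rule branch_group_comp[OF u pv(2)])
  show "fixes_ball k ?w" unfolding fixes_ball_def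
  proof (intro ballI impI)
    fix x assume x: "x \<in> vertices" "length (snd x) \<le> k"
    then have "inv_into vertices u x = inv_into vertices v x"
      using fun_cong[OF eq, of x] by (simp add: ball_restriction_def)
    then show "?w x = x" using pu(1) x by (metis comp_apply inverse_pair_def)
  qed
  show "u x = ?w (v x)" if "x \<in> vertices" for x
    using pv(1) that by (simp add: inverse_pair_def)
qed

text \<open>
  A tree identified with the coordinate model.  The word model carries the combinatorics; the maps act
  on the vertices of \<open>T\<close> through \<open>lift\<close>.
\<close>

locale coordinatized_tree =
  fixes T :: "'v pair_pre_digraph" and \<phi> :: "bool \<times> nat list \<Rightarrow> 'v"
  assumes \<phi>: "bij_betw \<phi> vertices (pverts T)"
    and arcs: "\<And>x y. x \<in> vertices \<Longrightarrow> y \<in> vertices \<Longrightarrow> (\<phi> x, \<phi> y) \<in> parcs T \<longleftrightarrow> adjacent x y"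
begin

definition lift :: "(bool \<times> nat list \<Rightarrow> bool \<times> nat list) \<Rightarrow> 'v \<Rightarrow> 'v" where
  "lift m v = (if v \<in> pverts T then \<phi> (m (inv_into vertices \<phi> v)) else v)"

abbreviation U :: "('v \<Rightarrow> 'v) set" where "U \<equiv> lift ` branch_group"

abbreviation H :: "('v \<Rightarrow> 'v) monoid" where "H \<equiv> perm_group (tree_aut_plus T)"

abbreviation G :: "('v \<Rightarrow> 'v) monoid" where "G \<equiv> H\<lparr>carrier := commensurator H U\<rparr>"

lemma \<phi>_in [simp]: "x \<in> vertices \<Longrightarrow> \<phi> x \<in> pverts T"
  using \<phi> by (auto simp: bij_betw_def)

lemma inv_\<phi>_in [simp]: "v \<in> pverts T \<Longrightarrow> inv_into vertices \<phi> v \<in> vertices"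
  using \<phi> by (metis bij_betw_imp_surj_on inv_into_into)

lemma \<phi>_eq [simp]: "x \<in> vertices \<Longrightarrow> y \<in> vertices \<Longrightarrow> \<phi> x = \<phi> y \<longleftrightarrow> x = y"
  using \<phi> by (auto simp: bij_betw_def inj_on_def)

lemma \<phi>_cases: assumes "v \<in> pverts T" obtains x where "x \<in> vertices" "v = \<phi> x"
  using \<phi> assms unfolding bij_betw_def by blast

lemma inv_\<phi> [simp]: "x \<in> vertices \<Longrightarrow> inv_into vertices \<phi> (\<phi> x) = x"
  using \<phi> by (simp add: bij_betw_def)

lemma lift_apply [simp]: "x \<in> vertices \<Longrightarrow> lift m (\<phi> x) = \<phi> (m x)"
  by (simp add: lift_def)

lemma lift_outside [simp]: "v \<notin> pverts T \<Longrightarrow> lift m v = v"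
  by (simp add: lift_def)

lemma lift_eqI: "(\<And>x. x \<in> vertices \<Longrightarrow> m x = k x) \<Longrightarrow> lift m = lift k"
proof
  fix v assume "\<And>x. x \<in> vertices \<Longrightarrow> m x = k x"
  then show "lift m v = lift k v"
    by (cases "v \<in> pverts T") (simp_all add: lift_def)
qed

lemma lift_comp:
  assumes "\<And>x. x \<in> vertices \<Longrightarrow> k x \<in> vertices" shows "lift m \<circ> lift k = lift (m \<circ> k)"
proof
  fix v
  show "(lift m \<circ> lift k) v = lift (m \<circ> k) v"
    by (cases "v \<in> pverts T") (simp_all add: assms lift_def)
qed

lemma lift_id [simp]: "lift id = id"
proof
  fix v show "lift id v = id v"
    using \<phi> by (cases "v \<in> pverts T") (simp_all add: lift_def bij_betw_inv_into_right)
qed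

lemma lift_inverse: assumes "inverse_pair m m'" shows "lift m \<circ> lift m' = id"
proof -
  have "lift m \<circ> lift m' = lift (m \<circ> m')" using assms by (intro lift_comp) (simp add: inverse_pair_def)
  also have "\<dots> = lift id" using assms by (intro lift_eqI) (simp add: inverse_pair_def)
  finally show ?thesis by simp
qed

text \<open>
  The tree is connected, so a vertex type is determined by its value at one vertex.
\<close>

lemma parity_determines_types:
  assumes t: "vertex_types T t" and x: "x \<in> vertices"
  shows "t (\<phi> x) \<longleftrightarrow> (t (\<phi> (True, [])) \<longleftrightarrow> parity x)"
  using x
proof (induction rule: vertex_induct)
  case (root b)
  have "(\<phi> (True, []), \<phi> (False, [])) \<in> parcs T" by (simp add: arcs adjacent_def)
  then have "t (\<phi> (True, [])) \<noteq> t (\<phi> (False, []))" using t by (auto simp: vertex_types_def)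
  then show ?case by (cases b) (auto simp: parity_def)
next
  case (child x i)
  then have "(\<phi> x, \<phi> (child x i)) \<in> parcs T" by (simp add: arcs)
  then have "t (\<phi> x) \<noteq> t (\<phi> (child x i))" using t by (auto simp: vertex_types_def)
  then show ?case using child by (auto simp: parity_def child_def)
qed

lemma lift_tree_aut_plus:
  assumes "model_aut m" shows "lift m \<in> tree_aut_plus T"
proof -
  have m: "bij_betw m vertices vertices" and mem: "\<And>x. x \<in> vertices \<Longrightarrow> m x \<in> vertices"
    using assms by (auto simp: model_aut_def bij_betw_def)
  have "bij_betw (\<phi> \<circ> m \<circ> inv_into vertices \<phi>) (pverts T) (pverts T)"
    using bij_betw_trans[OF bij_betw_trans[OF bij_betw_inv_into[OF \<phi>] m] \<phi>] by (simp add: comp_assoc)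
  then have "bij_betw (lift m) (pverts T) (pverts T)"
    by (rule bij_betw_cong[THEN iffD1, rotated]) (simp add: lift_def)
  then have "lift m permutes pverts T" by (rule bij_imp_permutes) simp
  moreover have "(lift m u, lift m v) \<in> parcs T \<longleftrightarrow> (u, v) \<in> parcs T"
    if uv: "u \<in> pverts T" "v \<in> pverts T" for u v
  proof -
    obtain x y where "x \<in> vertices" "y \<in> vertices" "u = \<phi> x" "v = \<phi> y"
      using uv \<phi>_cases by metis
    then show ?thesis using assms mem by (simp add: arcs model_aut_def)
  qed
  moreover have "t (lift m v) = t v" if t: "vertex_types T t" and v: "v \<in> pverts T" for t v
  proof -
    obtain x where x: "x \<in> vertices" "v = \<phi> x" using v \<phi>_cases by metis
    then have "parity (m x) = parity x" using assms by (simp add: model_aut_def)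
    then show ?thesis
      using parity_determines_types[OF t x(1)] parity_determines_types[OF t mem[OF x(1)]] x by simp
  qed
  ultimately show ?thesis by (simp add: tree_aut_plus_def tree_aut_def)
qed

lemma U_subset_carrier: "U \<subseteq> tree_aut_plus T"
  using branch_group_model_aut lift_tree_aut_plus by auto

text \<open>
  If conjugation by \<open>m\<close> and by \<open>m'\<close> takes the stabilizer of the ball of radius \<open>k\<close> into the branch group, then
  the intersection of the branch group with its conjugate contains that stabilizer and its conjugate.
  Both have finite index, because an element of the branch group has finitely many restrictions to the ball.
\<close>

lemma lift_commensurator:
  assumes pair: "inverse_pair m m'" and aut: "model_aut m" "model_aut m'"
    and comm: "commensurating m m'"
  shows "lift m \<in> commensurator H U"
proof -
  have mem: "m x \<in> vertices" "m' x \<in> vertices" "m' (m x) = x" "m (m' x) = x" if "x \<in> vertices" for x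
    using pair that by (auto simp: inverse_pair_def)
  have inv: "inv\<^bsub>H\<^esub> (lift m) = lift m'"
    by (intro m_inv_perm_group lift_tree_aut_plus aut lift_inverse inverse_pair_sym[OF pair] pair)
  define conj where "conj u = lift (m \<circ> u \<circ> m')" for u
  have conj_comp: "conj u \<circ> conj v = conj (u \<circ> v)" if "v \<in> branch_group" for u v
  proof -
    have "conj u \<circ> conj v = lift ((m \<circ> u \<circ> m') \<circ> (m \<circ> v \<circ> m'))"
      unfolding conj_def using that by (intro lift_comp) (simp add: branch_group_mem mem)
    also have "\<dots> = conj (u \<circ> v)"
      unfolding conj_def using that by (intro lift_eqI) (simp add: branch_group_mem mem)
    finally show ?thesis .
  qed
  have conjU: "conjugate_set H (lift m) U = conj ` branch_group"
  proof -
    have "lift m \<circ> lift u \<circ> lift m' = conj u" if "u \<in> branch_group" for u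
    proof -
      have "lift m \<circ> lift u = lift (m \<circ> u)" using that by (intro lift_comp) (simp add: branch_group_mem)
      then show ?thesis unfolding conj_def using lift_comp[of m' "m \<circ> u"] mem by simp
    qed
    then show ?thesis unfolding conjugate_set_def inv by (simp add: image_image)
  qed
  have closed: "h \<circ> k \<in> U \<inter> conj ` branch_group"
    if hk: "h \<in> U \<inter> conj ` branch_group" "k \<in> U \<inter> conj ` branch_group" for h k
  proof -
    obtain u v where uv: "u \<in> branch_group" "v \<in> branch_group" "h = lift u" "k = lift v" using hk by blast
    obtain u' v' where uv': "u' \<in> branch_group" "v' \<in> branch_group" "h = conj u'" "k = conj v'"
      using hk by blast
    have "h \<circ> k = lift (u \<circ> v)" using uv lift_comp branch_group_mem by metis
    moreover have "h \<circ> k = conj (u' \<circ> v')" using uv' conj_comp by simp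
    ultimately show ?thesis using uv uv' branch_group_comp by blast
  qed
  obtain k where k: "\<And>u. u \<in> branch_group \<Longrightarrow> fixes_ball k u \<Longrightarrow>
      m \<circ> u \<circ> m' \<in> branch_group \<and> m' \<circ> u \<circ> m \<in> branch_group"
    using comm unfolding commensurating_def by blast
  have "finite_index H (U \<inter> conj ` branch_group) U"
  proof (rule finite_index_perm_group[OF closed refl finite_ball_restrictions[of k]])
    fix u v assume uv: "u \<in> branch_group" "v \<in> branch_group" "ball_restriction k u = ball_restriction k v"
    obtain w where w: "w \<in> branch_group" "fixes_ball k w" "\<And>x. x \<in> vertices \<Longrightarrow> u x = w (v x)"
      using ball_restriction_eq[OF uv] by blast
    have "lift w = conj (m' \<circ> w \<circ> m)"
      unfolding conj_def using w(1) by (intro lift_eqI) (simp add: mem branch_group_mem)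
    then have "lift w \<in> U \<inter> conj ` branch_group" using k[OF w(1,2)] w(1) by blast
    moreover have "lift u = lift w \<circ> lift v"
      using w(3) lift_comp[of v w, OF branch_group_mem[OF uv(2)]]
      by (metis (no_types, lifting) comp_apply lift_eqI)
    ultimately show "\<exists>g\<in>U \<inter> conj ` branch_group. lift u = g \<circ> lift v" by blast
  qed
  moreover have "finite_index H (U \<inter> conj ` branch_group) (conj ` branch_group)"
  proof (rule finite_index_perm_group[OF closed refl finite_ball_restrictions[of k]])
    fix u v assume uv: "u \<in> branch_group" "v \<in> branch_group" "ball_restriction k u = ball_restriction k v"
    obtain w where w: "w \<in> branch_group" "fixes_ball k w" "\<And>x. x \<in> vertices \<Longrightarrow> u x = w (v x)"
      using ball_restriction_eq[OF uv] by blast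
    have "conj w \<in> U \<inter> conj ` branch_group" using k[OF w(1,2)] w(1) by (auto simp: conj_def)
    moreover have "conj u = conj w \<circ> conj v"
      unfolding conj_comp[OF uv(2)] unfolding conj_def
      using w(3) by (intro lift_eqI) (simp add: mem)
    ultimately show "\<exists>g\<in>U \<inter> conj ` branch_group. conj u = g \<circ> conj v" by blast
  qed
  ultimately show ?thesis
    using lift_tree_aut_plus[OF aut(1)] by (simp add: commensurator_def conjU)
qed

lemma double_shift_in_G: "lift (double_shift b) \<in> carrier G"
  using lift_commensurator[OF double_shift_pair double_shift_model_aut double_shift_model_aut
      double_shift_commensurating] by simp

lemma cone_twist_in_G:
  assumes s: "\<And>j. s j \<in> klein_normalizer" shows "lift (cone_twist s) \<in> carrier G"
proof -
  have p: "s j permutes {1..4}" for j using s by (auto simp: klein_normalizer_def)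
  have "lift (cone_twist s) \<in> commensurator H U"
    by (rule lift_commensurator[OF cone_twist_pair cone_twist_model_aut cone_twist_model_aut
          cone_twist_commensurating]) (use p s permutes_inv in auto)
  then show ?thesis by simp
qed

lemma U_subset_G: "U \<subseteq> carrier G"
proof
  fix g assume "g \<in> U"
  then obtain u where u: "u \<in> branch_group" "g = lift u" by blast
  note u' = branch_group_inv_into[OF u(1)]
  have "commensurating u (inv_into vertices u)"
    unfolding commensurating_def using u u' branch_group_comp by blast
  then show "g \<in> carrier G"
    using lift_commensurator[OF u'(1) branch_group_model_aut branch_group_model_aut] u u' by simp
qed

end

section \<open>Normal subgroups of the commensurator\<close>

lemma double_shift_cone:
  "double_shift b (b, w) = (b, 1 # 1 # w)"
  "double_shift b (True, 2 # u) = (if b then (b, 1 # 1 # 2 # u) else (b, 1 # 2 # u))"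
  by (auto simp: double_shift_def shift_def)

text \<open>
  The Klein group is transitive on letters, hence its levelwise automorphisms are transitive on each level.
\<close>

lemma levelwise_replicate:
  assumes "w \<in> lists {1..4}"
  obtains s where "\<And>j. s j \<in> klein_four" "levelwise s (replicate (length w) 1) = w"
proof -
  have "\<exists>f\<in>klein_four. j < length w \<longrightarrow> f 1 = w ! j" for j
  proof (cases "j < length w")
    case True
    then have "w ! j \<in> {1..4}" using assms nth_mem[OF True] by (auto simp: in_lists_conv_set)
    then show ?thesis using klein_four_transitive by blast
  qed (use klein_four_id in blast)
  then obtain s where s: "\<And>j. s j \<in> klein_four" "\<And>j. j < length w \<Longrightarrow> s j 1 = w ! j" by metis
  have "levelwise s (replicate (length w) 1) = w"
    by (rule nth_equalityI) (auto simp: s levelwise_def)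
  then show ?thesis using s that by blast
qed

context coordinatized_tree
begin

lemma mult_G [simp]: "x \<otimes>\<^bsub>G\<^esub> y = x \<circ> y"
  and one_G [simp]: "\<one>\<^bsub>G\<^esub> = id"
  by (simp_all add: perm_group_def)

lemma carrier_G_subset: "carrier G \<subseteq> tree_aut_plus T"
  by (auto simp: commensurator_def)

lemma inv_G_comp:
  assumes "group G" "g \<in> carrier G"
  shows "inv\<^bsub>G\<^esub> g \<circ> g = id" "g \<circ> inv\<^bsub>G\<^esub> g = id"
  using group.l_inv[OF assms] group.r_inv[OF assms] by (simp_all del: carrier_perm_group)

lemma inv_G_lift:
  assumes "group G" "inverse_pair m m'" "lift m \<in> carrier G" "lift m' \<in> carrier G"
  shows "inv\<^bsub>G\<^esub> (lift m) = lift m'"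
  by (rule group.inv_equality[OF assms(1)])
    (use assms lift_inverse[OF inverse_pair_sym] in auto)

lemma inv_G_cone_twist:
  assumes "group G" and s: "\<And>j. s j \<in> klein_normalizer"
  shows "inv\<^bsub>G\<^esub> (lift (cone_twist s)) = lift (cone_twist (\<lambda>j. inv_into UNIV (s j)))"
proof (rule inv_G_lift[OF assms(1) cone_twist_pair])
  show "s j permutes {1..4}" for j using s by (auto simp: klein_normalizer_def)
qed (rule cone_twist_in_G, simp add: s klein_normalizer_inv)+

text \<open>
  An even power of a shift moves the cone below \<open>(True, [2])\<close> arbitrarily deep into side \<open>b\<close>, below a vertex
  whose word consists of ones; a levelwise element of the branch group moves that vertex to any other
  vertex of the same level.
\<close>

lemma cone_absorbed:
  assumes G: "group G" and w: "w \<in> lists {1..4}"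
  obtains h where "h \<in> carrier G" "\<And>y. y \<in> cone_at (True, [2]) \<Longrightarrow> h (\<phi> y) \<in> \<phi> ` cone_at (b, w)"
proof -
  have "\<exists>g\<in>carrier G. \<exists>k\<ge>n. \<forall>u\<in>lists {1..4}. g (\<phi> (True, 2 # u)) = \<phi> (b, replicate k 1 @ 2 # u)" for n
  proof (induction n)
    case 0
    have "lift (double_shift b) (\<phi> (True, 2 # u)) = \<phi> (b, replicate (Suc (if b then Suc 0 else 0)) 1 @ 2 # u)"
      if "u \<in> lists {1..4}" for u
    proof -
      have "(True, 2 # u) \<in> vertices" using that by simp
      then show ?thesis unfolding lift_apply[OF \<open>(True, 2 # u) \<in> vertices\<close>] double_shift_cone
        by simp
    qed
    then show ?case using double_shift_in_G by blast
  next
    case (Suc n)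
    then obtain g k where g: "g \<in> carrier G" "k \<ge> n"
        "\<And>u. u \<in> lists {1..4} \<Longrightarrow> g (\<phi> (True, 2 # u)) = \<phi> (b, replicate k 1 @ 2 # u)" by blast
    have "(lift (double_shift b) \<circ> g) (\<phi> (True, 2 # u)) = \<phi> (b, replicate (Suc (Suc k)) 1 @ 2 # u)"
      if "u \<in> lists {1..4}" for u
    proof -
      have "(b, replicate k 1 @ 2 # u) \<in> vertices" using that by (auto simp: in_lists_conv_set)
      then show ?thesis using g(3)[OF that] by (simp add: double_shift_cone)
    qed
    moreover have "lift (double_shift b) \<circ> g \<in> carrier G"
      using group.subgroup_self[OF G] subgroup.m_closed[of "carrier G" G] double_shift_in_G g(1)
      by (metis mult_G)
    moreover have "Suc (Suc k) \<ge> Suc n" using g(2) by simp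
    ultimately show ?case by blast
  qed
  then obtain g k where g: "g \<in> carrier G" "k \<ge> length w"
      "\<And>u. u \<in> lists {1..4} \<Longrightarrow> g (\<phi> (True, 2 # u)) = \<phi> (b, replicate k 1 @ 2 # u)" by blast
  obtain s where s: "\<And>j. s j \<in> klein_four" "levelwise s (replicate (length w) 1) = w"
    using levelwise_replicate[OF w] by metis
  have l: "lift (levelwise_aut s) \<in> carrier G"
    using U_subset_G levelwise_aut_in_branch_group[of s] s(1) by blast
  have "(lift (levelwise_aut s) \<circ> g) (\<phi> y) \<in> \<phi> ` cone_at (b, w)" if y: "y \<in> cone_at (True, [2])" for y
  proof -
    obtain u where u: "u \<in> lists {1..4}" "y = (True, 2 # u)" using y by (auto simp: cone_at_def)
    \<comment> \<open>The first \<open>length w\<close> ones become \<open>w\<close>; whatever happens to the rest stays below \<open>w\<close>.\<close>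
    let ?t = "replicate (k - length w) 1 @ 2 # u"
    have t: "?t \<in> lists {1..4}" using u(1) by (auto simp: in_lists_conv_set)
    have split: "replicate k 1 @ 2 # u = replicate (length w) 1 @ ?t"
      using g(2) by (simp flip: append_assoc replicate_add)
    have "(b, replicate k 1 @ 2 # u) \<in> vertices" using u(1) by (auto simp: in_lists_conv_set)
    then have "(lift (levelwise_aut s) \<circ> g) (\<phi> y) = \<phi> (levelwise_aut s (b, replicate k 1 @ 2 # u))"
      using g(3)[OF u(1)] u(2) by simp
    also have "levelwise_aut s (b, replicate k 1 @ 2 # u)
        = (b, w @ levelwise (\<lambda>j. s (length w + j)) ?t)"
      unfolding split levelwise_aut_def by (simp add: levelwise_append s)
    finally show ?thesis
      using levelwise_in_lists[OF klein_four_permutes[OF s(1)] t] by (auto simp: cone_at_def)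
  qed
  moreover have "lift (levelwise_aut s) \<circ> g \<in> carrier G"
    using group.subgroup_self[OF G] subgroup.m_closed[of "carrier G" G] l g(1) by (metis mult_G)
  ultimately show ?thesis using that by blast
qed

lemma nontrivial_moves_cone:
  assumes g: "g \<in> tree_aut T" "g \<noteq> id"
  obtains x where "x \<in> vertices" "\<And>y. y \<in> cone_at x \<Longrightarrow> g (\<phi> y) \<notin> \<phi> ` cone_at x"
proof -
  define n where "n = inv_into vertices \<phi> \<circ> g \<circ> \<phi>"
  have perm: "g permutes pverts T" using g by (simp add: tree_aut_def)
  have n: "bij_betw n vertices vertices"
    unfolding n_def using bij_betw_trans[OF bij_betw_trans[OF \<phi> permutes_imp_bij[OF perm]] bij_betw_inv_into[OF \<phi>]]
    by (simp add: comp_assoc)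
  have gn: "g (\<phi> x) = \<phi> (n x)" "n x \<in> vertices" if "x \<in> vertices" for x
    using permutes_in_image[OF perm, of "\<phi> x"] that \<phi>
    by (simp_all add: n_def bij_betw_inv_into_right)
  have adj: "adjacent (n x) (n y)" if "x \<in> vertices" "y \<in> vertices" "adjacent x y" for x y
  proof -
    have "(\<phi> x, \<phi> y) \<in> parcs T" using that arcs by simp
    then have "(g (\<phi> x), g (\<phi> y)) \<in> parcs T" using g that by (simp add: tree_aut_def)
    then show ?thesis using gn that arcs by simp
  qed
  obtain v where "g v \<noteq> v" using g(2) by (metis ext id_apply)
  then have "v \<in> pverts T" using permutes_not_in[OF perm] by blast
  then obtain x where x: "x \<in> vertices" "v = \<phi> x" using \<phi>_cases by metis
  then have "n x \<noteq> x" using gn \<open>g v \<noteq> v\<close> by auto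
  then obtain i where i: "i \<in> {1..4}" "n ` cone_at (child x i) \<inter> cone_at (child x i) = {}"
    using moved_cone_disjoint[OF n adj x(1)] by blast
  have sub: "cone_at (child x i) \<subseteq> vertices" by (rule cone_subset_vertices) (use i x in simp)
  have "g (\<phi> y) \<notin> \<phi> ` cone_at (child x i)" if y: "y \<in> cone_at (child x i)" for y
  proof
    assume "g (\<phi> y) \<in> \<phi> ` cone_at (child x i)"
    then obtain z where z: "z \<in> cone_at (child x i)" "g (\<phi> y) = \<phi> z" by blast
    then have "n y = z" using gn sub y by (metis \<phi>_eq subsetD)
    then show False using i y z by blast
  qed
  then show ?thesis using that[of "child x i"] i x by simp
qed

text \<open>
  Conjugating by an element that absorbs the fixed cone into a displaced one gives, in every non-trivial
  normal subgroup, an element displacing the same fixed cone.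
\<close>

lemma cone_displaced:
  assumes G: "group G" and N: "N \<lhd> G" and ne: "N \<noteq> {id}"
  obtains n where "n \<in> N"
    "\<And>y. y \<in> cone_at (True, [2]) \<Longrightarrow> n (\<phi> y) \<notin> \<phi> ` cone_at (True, [2])"
proof -
  have sub: "subgroup N G" using N by (simp add: normal_imp_subgroup)
  then have "id \<in> N" using subgroup.one_closed[OF sub] by simp
  then obtain n where n: "n \<in> N" "n \<noteq> id" using ne by blast
  have nG: "n \<in> carrier G" using subgroup.mem_carrier[OF sub n(1)] .
  then have "n \<in> tree_aut T" using carrier_G_subset by (auto simp: tree_aut_plus_def)
  then obtain x where x: "x \<in> vertices" "\<And>y. y \<in> cone_at x \<Longrightarrow> n (\<phi> y) \<notin> \<phi> ` cone_at x"
    using nontrivial_moves_cone n(2) by metis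
  obtain h where h: "h \<in> carrier G" "\<And>y. y \<in> cone_at (True, [2]) \<Longrightarrow> h (\<phi> y) \<in> \<phi> ` cone_at x"
    using cone_absorbed[OF G, of "snd x" "fst x"] x(1) by (metis prod.collapse vertices_iff)
  have mem: "inv\<^bsub>G\<^esub> h \<circ> n \<circ> h \<in> N" using normal.inv_op_closed1[OF N h(1) n(1)] by simp
  have hh: "h ((inv\<^bsub>G\<^esub> h) v) = v" for v using inv_G_comp(2)[OF G h(1)] by (metis comp_apply id_apply)
  have "(inv\<^bsub>G\<^esub> h \<circ> n \<circ> h) (\<phi> y) \<notin> \<phi> ` cone_at (True, [2])" if y: "y \<in> cone_at (True, [2])" for y
  proof
    assume "(inv\<^bsub>G\<^esub> h \<circ> n \<circ> h) (\<phi> y) \<in> \<phi> ` cone_at (True, [2])"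
    then have "h ((inv\<^bsub>G\<^esub> h) (n (h (\<phi> y)))) \<in> \<phi> ` cone_at x" using h(2) by auto
    then have "n (h (\<phi> y)) \<in> \<phi> ` cone_at x" by (simp add: hh)
    moreover obtain z where "z \<in> cone_at x" "h (\<phi> y) = \<phi> z" using h(2)[OF y] by blast
    ultimately show False using x(2) by metis
  qed
  then show ?thesis using that[OF mem] by blast
qed

text \<open>
  The double commutator trick: \<open>d\<close>, the conjugate of \<open>inv a\<close> by \<open>n\<close>, is supported on \<open>n(S)\<close>, which is disjoint from
  \<open>S\<close>, so it commutes with \<open>b\<close>.  Hence the commutator of \<open>[a, n] = a d\<close> with \<open>b\<close>, which is in \<open>N\<close>, equals the
  commutator of \<open>a\<close> with \<open>b\<close>.
\<close>

lemma commutator_in_normal: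
  assumes G: "group G" and N: "N \<lhd> G"
    and ab: "a \<in> carrier G" "b \<in> carrier G"
    and supp: "\<And>v. v \<notin> S \<Longrightarrow> a v = v" "\<And>v. v \<notin> S \<Longrightarrow> b v = v"
    and stable: "\<And>v. v \<in> S \<Longrightarrow> b v \<in> S"
    and n: "n \<in> N" "\<And>v. v \<in> S \<Longrightarrow> n v \<notin> S"
  shows "a \<circ> b \<circ> inv\<^bsub>G\<^esub> a \<circ> inv\<^bsub>G\<^esub> b \<in> N"
proof -
  interpret group G by (rule G)
  have sub: "subgroup N G" using N by (simp add: normal_imp_subgroup)
  have nG: "n \<in> carrier G" using subgroup.mem_carrier[OF sub n(1)] .
  have cancel: "g ((inv\<^bsub>G\<^esub> g) v) = v" "(inv\<^bsub>G\<^esub> g) (g v) = v" if "g \<in> carrier G" for g v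
    using inv_G_comp[OF G that] by (metis comp_apply id_apply)+
  define d where "d = n \<otimes>\<^bsub>G\<^esub> inv\<^bsub>G\<^esub> a \<otimes>\<^bsub>G\<^esub> inv\<^bsub>G\<^esub> n"
  have dG: "d \<in> carrier G" unfolding d_def using ab nG by (intro m_closed inv_closed)
  have d_fix: "d v = v" if v: "v \<in> S" for v
  proof -
    have "(inv\<^bsub>G\<^esub> n) v \<notin> S" using n(2) v cancel(1)[OF nG] by metis
    then have "(inv\<^bsub>G\<^esub> a) ((inv\<^bsub>G\<^esub> n) v) = (inv\<^bsub>G\<^esub> n) v" using supp(1) cancel(2)[OF ab(1)] by metis
    then show ?thesis unfolding d_def using cancel(1)[OF nG] by simp
  qed
  have db: "d \<otimes>\<^bsub>G\<^esub> b = b \<otimes>\<^bsub>G\<^esub> d"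
  proof -
    have "d (b v) = b (d v)" for v
    proof (cases "v \<in> S")
      case True
      then show ?thesis using d_fix stable by simp
    next
      case False
      have "d v \<notin> S" using d_fix False cancel(2)[OF dG] by metis
      then show ?thesis using supp(2) False by simp
    qed
    then show ?thesis by (simp add: fun_eq_iff)
  qed
  define k where "k = a \<otimes>\<^bsub>G\<^esub> d"
  have kG: "k \<in> carrier G" unfolding k_def using ab dG by (intro m_closed)
  have "a \<otimes>\<^bsub>G\<^esub> n \<otimes>\<^bsub>G\<^esub> inv\<^bsub>G\<^esub> a \<otimes>\<^bsub>G\<^esub> inv\<^bsub>G\<^esub> n \<in> N"
    using normal.inv_op_closed2[OF N ab(1) n(1)] n(1) subgroup.m_closed[OF sub]
      subgroup.m_inv_closed[OF sub] by blast
  moreover have "a \<otimes>\<^bsub>G\<^esub> n \<otimes>\<^bsub>G\<^esub> inv\<^bsub>G\<^esub> a \<otimes>\<^bsub>G\<^esub> inv\<^bsub>G\<^esub> n = k"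
    unfolding k_def d_def using ab nG by (simp only: m_assoc m_closed inv_closed)
  ultimately have kN: "k \<in> N" by simp
  then have "k \<otimes>\<^bsub>G\<^esub> (b \<otimes>\<^bsub>G\<^esub> inv\<^bsub>G\<^esub> k \<otimes>\<^bsub>G\<^esub> inv\<^bsub>G\<^esub> b) \<in> N"
    using normal.inv_op_closed2[OF N ab(2)] subgroup.m_closed[OF sub] subgroup.m_inv_closed[OF sub]
    by blast
  moreover have "k \<otimes>\<^bsub>G\<^esub> (b \<otimes>\<^bsub>G\<^esub> inv\<^bsub>G\<^esub> k \<otimes>\<^bsub>G\<^esub> inv\<^bsub>G\<^esub> b)
      = a \<otimes>\<^bsub>G\<^esub> b \<otimes>\<^bsub>G\<^esub> inv\<^bsub>G\<^esub> a \<otimes>\<^bsub>G\<^esub> inv\<^bsub>G\<^esub> b"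
  proof -
    have "k \<otimes>\<^bsub>G\<^esub> (b \<otimes>\<^bsub>G\<^esub> inv\<^bsub>G\<^esub> k \<otimes>\<^bsub>G\<^esub> inv\<^bsub>G\<^esub> b)
        = a \<otimes>\<^bsub>G\<^esub> (d \<otimes>\<^bsub>G\<^esub> b) \<otimes>\<^bsub>G\<^esub> inv\<^bsub>G\<^esub> d \<otimes>\<^bsub>G\<^esub> inv\<^bsub>G\<^esub> a \<otimes>\<^bsub>G\<^esub> inv\<^bsub>G\<^esub> b"
      unfolding k_def using ab dG by (simp only: inv_mult_group m_assoc m_closed inv_closed)
    also have "\<dots> = a \<otimes>\<^bsub>G\<^esub> b \<otimes>\<^bsub>G\<^esub> (d \<otimes>\<^bsub>G\<^esub> inv\<^bsub>G\<^esub> d) \<otimes>\<^bsub>G\<^esub> inv\<^bsub>G\<^esub> a \<otimes>\<^bsub>G\<^esub> inv\<^bsub>G\<^esub> b"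
      unfolding db using ab dG by (simp only: m_assoc m_closed inv_closed)
    also have "\<dots> = a \<otimes>\<^bsub>G\<^esub> b \<otimes>\<^bsub>G\<^esub> inv\<^bsub>G\<^esub> a \<otimes>\<^bsub>G\<^esub> inv\<^bsub>G\<^esub> b"
      using ab dG by (simp only: r_inv r_one m_closed)
    finally show ?thesis .
  qed
  ultimately show ?thesis by simp
qed

lemma cone_twist_commutator_in_normal:
  assumes G: "group G" and N: "N \<lhd> G" "N \<noteq> {id}"
    and s: "\<And>j. s j \<in> klein_normalizer" and t: "\<And>j. t j \<in> klein_normalizer"
  shows "lift (cone_twist (\<lambda>j. s j \<circ> t j \<circ> inv_into UNIV (s j) \<circ> inv_into UNIV (t j))) \<in> N"
proof -
  let ?S = "\<phi> ` cone_at (True, [2])"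
  have sub: "cone_at (True, [2]) \<subseteq> vertices" by (rule cone_subset_vertices) simp
  have perm: "r j permutes {1..4}" if "\<And>j. r j \<in> klein_normalizer" for r :: "nat \<Rightarrow> nat \<Rightarrow> nat" and j
    using that by (auto simp: klein_normalizer_def)
  have fix_out: "lift (cone_twist r) v = v" if "v \<notin> ?S" for r v
  proof (cases "v \<in> pverts T")
    case True
    then obtain x where x: "x \<in> vertices" "v = \<phi> x" using \<phi>_cases by metis
    then have "x \<notin> cone_at (True, [2])" using that by blast
    then show ?thesis using x by (simp add: cone_twist_simps)
  qed simp
  have stays: "lift (cone_twist t) v \<in> ?S" if "v \<in> ?S" for v
    using that sub cone_twist_cone[of t, OF perm[of t, OF t]] by auto
  obtain n where n: "n \<in> N" "\<And>y. y \<in> cone_at (True, [2]) \<Longrightarrow> n (\<phi> y) \<notin> ?S"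
    using cone_displaced[OF G N] by blast
  have "lift (cone_twist s) \<circ> lift (cone_twist t) \<circ> inv\<^bsub>G\<^esub> (lift (cone_twist s)) \<circ>
      inv\<^bsub>G\<^esub> (lift (cone_twist t)) \<in> N"
    by (rule commutator_in_normal[OF G N(1) cone_twist_in_G[of s, OF s] cone_twist_in_G[of t, OF t]
          fix_out fix_out stays n(1)]) (use n(2) in auto)
  moreover have "lift (cone_twist q) \<circ> lift (cone_twist r) = lift (cone_twist (\<lambda>j. q j \<circ> r j))"
    if r: "\<And>j. r j permutes {1..4}" for q r
  proof -
    have "cone_twist r x \<in> vertices" if "x \<in> vertices" for x
      using cone_twist_pair[of r, OF r] that by (simp add: inverse_pair_def)
    then show ?thesis using lift_comp[of "cone_twist r" "cone_twist q"] cone_twist_comp[of r q, OF r] by simp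
  qed
  ultimately show ?thesis
    using inv_G_cone_twist[OF G, of s, OF s] inv_G_cone_twist[OF G, of t, OF t] perm[of t, OF t]
      permutes_inv[OF perm[of s, OF s]] permutes_inv[OF perm[of t, OF t]] by simp
qed

end

section \<open>Uncountably many cosets in the monolith\<close>

text \<open>
  The left cosets of an open subgroup are open and partition the group, so a compact set meets only
  finitely many of them.
\<close>

lemma sigma_compact_meets_countably_many_cosets:
  assumes top: "topological_group G \<tau>" and U: "openin \<tau> U" "subgroup U G"
    and M: "M \<subseteq> carrier G" "sigma_compact_space (subtopology \<tau> M)"
    and Y: "Y \<subseteq> M" "\<And>y z. y \<in> Y \<Longrightarrow> z \<in> Y \<Longrightarrow> inv\<^bsub>G\<^esub> y \<otimes>\<^bsub>G\<^esub> z \<in> U \<Longrightarrow> y = z"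
  shows "countable Y"
proof -
  interpret group G using top by (simp add: topological_group_def)
  have carrier: "topspace \<tau> = carrier G" using top by (simp add: topological_group_def)
  define coset where "coset x = {z \<in> carrier G. inv\<^bsub>G\<^esub> x \<otimes>\<^bsub>G\<^esub> z \<in> U}" for x
  have coset_open: "openin \<tau> (coset x)" if x: "x \<in> carrier G" for x
  proof -
    have "continuous_map (prod_topology \<tau> \<tau>) \<tau> (\<lambda>(x, y). x \<otimes>\<^bsub>G\<^esub> y)"
      using top by (simp add: topological_group_def)
    moreover have "continuous_map \<tau> (prod_topology \<tau> \<tau>) (\<lambda>z. (inv\<^bsub>G\<^esub> x, z))"
      using x carrier by (simp add: continuous_map_pairedI)
    ultimately have "continuous_map \<tau> \<tau> ((\<lambda>(x, y). x \<otimes>\<^bsub>G\<^esub> y) \<circ> (\<lambda>z. (inv\<^bsub>G\<^esub> x, z)))"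
      by (rule continuous_map_compose[rotated])
    then have "continuous_map \<tau> \<tau> (\<lambda>z. inv\<^bsub>G\<^esub> x \<otimes>\<^bsub>G\<^esub> z)" by (simp add: o_def)
    from openin_continuous_map_preimage[OF this U(1)] show ?thesis
      by (simp add: coset_def carrier)
  qed
  have coset_self: "x \<in> coset x" if "x \<in> carrier G" for x
    using that subgroup.one_closed[OF U(2)] by (simp add: coset_def)
  have coset_meets: "finite (coset x \<inter> Y)" if x: "x \<in> carrier G" for x
  proof -
    have "y = z" if yz: "y \<in> coset x \<inter> Y" "z \<in> coset x \<inter> Y" for y z
    proof -
      have m: "y \<in> carrier G" "z \<in> carrier G" "inv\<^bsub>G\<^esub> x \<otimes>\<^bsub>G\<^esub> y \<in> U" "inv\<^bsub>G\<^esub> x \<otimes>\<^bsub>G\<^esub> z \<in> U"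
        using yz by (auto simp: coset_def)
      then have "inv\<^bsub>G\<^esub> (inv\<^bsub>G\<^esub> x \<otimes>\<^bsub>G\<^esub> y) \<otimes>\<^bsub>G\<^esub> (inv\<^bsub>G\<^esub> x \<otimes>\<^bsub>G\<^esub> z) \<in> U"
        using subgroup.m_closed[OF U(2)] subgroup.m_inv_closed[OF U(2)] by blast
      moreover have "inv\<^bsub>G\<^esub> (inv\<^bsub>G\<^esub> x \<otimes>\<^bsub>G\<^esub> y) \<otimes>\<^bsub>G\<^esub> (inv\<^bsub>G\<^esub> x \<otimes>\<^bsub>G\<^esub> z) = inv\<^bsub>G\<^esub> y \<otimes>\<^bsub>G\<^esub> z"
      proof -
        have "inv\<^bsub>G\<^esub> (inv\<^bsub>G\<^esub> x \<otimes>\<^bsub>G\<^esub> y) = inv\<^bsub>G\<^esub> y \<otimes>\<^bsub>G\<^esub> x"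
          using inv_mult_group[OF inv_closed[OF x] m(1)] inv_inv[OF x] by metis
        moreover have "x \<otimes>\<^bsub>G\<^esub> (inv\<^bsub>G\<^esub> x \<otimes>\<^bsub>G\<^esub> z) = z"
          using m_assoc[OF x inv_closed[OF x] m(2)] r_inv[OF x] l_one[OF m(2)] by metis
        ultimately show ?thesis
          using m_assoc[OF inv_closed[OF m(1)] x m_closed[OF inv_closed[OF x] m(2)]] by metis
      qed
      ultimately show ?thesis using Y(2)[of y z] yz by simp
    qed
    then have "\<exists>y. coset x \<inter> Y \<subseteq> {y}" by blast
    then show ?thesis by (metis finite.emptyI finite.insertI finite_subset)
  qed
  obtain \<K> where \<K>: "countable \<K>" "\<And>C. C \<in> \<K> \<Longrightarrow> compactin (subtopology \<tau> M) C"
      "\<Union>\<K> = topspace (subtopology \<tau> M)"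
    using M(2) by (auto simp: sigma_compact_space_def)
  have "finite (C \<inter> Y)" if "C \<in> \<K>" for C
  proof -
    have C: "compactin \<tau> C" "C \<subseteq> M" using \<K>(2)[OF that] by (auto simp: compactin_subtopology)
    have "\<exists>\<F>. finite \<F> \<and> \<F> \<subseteq> coset ` C \<and> C \<subseteq> \<Union>\<F>"
    proof (rule compactinD[OF C(1)])
      show "C \<subseteq> \<Union> (coset ` C)" using C(2) M(1) coset_self by blast
    qed (use C(2) M(1) coset_open in auto)
    then obtain \<F> where \<F>: "finite \<F>" "\<F> \<subseteq> coset ` C" "C \<subseteq> \<Union>\<F>" by blast
    have "finite (F \<inter> Y)" if "F \<in> \<F>" for F
      using that \<F>(2) C(2) M(1) coset_meets by blast
    then have "finite (\<Union>F\<in>\<F>. F \<inter> Y)" using \<F>(1) by blast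
    then show ?thesis by (rule rev_finite_subset) (use \<F>(3) in blast)
  qed
  then have "countable (\<Union>C\<in>\<K>. C \<inter> Y)"
    by (rule countable_UN[OF \<K>(1) countable_finite])
  moreover have "Y \<subseteq> (\<Union>C\<in>\<K>. C \<inter> Y)" using \<K>(3) Y(1) M(1) carrier by fastforce
  ultimately show ?thesis by (rule countable_subset[rotated])
qed

lemma uncountable_binary_sequences: "uncountable (UNIV :: (nat \<Rightarrow> bool) set)"
proof
  assume "countable (UNIV :: (nat \<Rightarrow> bool) set)"
  then have "range (from_nat_into (UNIV :: (nat \<Rightarrow> bool) set)) = UNIV" by (intro range_from_nat_into) auto
  then obtain f :: "nat \<Rightarrow> nat \<Rightarrow> bool" where f: "range f = UNIV" by blast
  then obtain n where "f n = (\<lambda>k. \<not> f k k)" by (metis UNIV_I imageE)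
  then show False by (metis (full_types))
qed

text \<open>
  The commutator of the transpositions \<open>(1 2)\<close> and \<open>(2 3)\<close>, in the form in which it arises from
  \<open>cone_twist_commutator_in_normal\<close>.
\<close>

definition three_cycle :: "nat \<Rightarrow> nat" where
  "three_cycle = Transposition.transpose 1 2 \<circ> Transposition.transpose 2 3 \<circ>
     Transposition.transpose 1 2 \<circ> Transposition.transpose 2 3"

lemma three_cycle_props:
  "three_cycle permutes {1..4}" "three_cycle 1 \<noteq> 1" "three_cycle 4 = 4"
  by (auto simp: three_cycle_def Transposition.transpose_def intro!: permutes_compose permutes_swap_id)

lemma three_cycle_normalizer: "three_cycle \<in> klein_normalizer"
  unfolding three_cycle_def by (intro klein_normalizer_comp klein_normalizer_transposition) auto

definition selection :: "(nat \<Rightarrow> bool) \<Rightarrow> nat \<Rightarrow> nat \<Rightarrow> nat" where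
  "selection x j = (if x j then three_cycle else id)"

lemma selection_normalizer: "selection x j \<in> klein_normalizer"
  by (simp add: selection_def klein_normalizer_id three_cycle_normalizer)

lemma selection_permutes: "selection x j permutes {1..4}"
  using selection_normalizer by (auto simp: klein_normalizer_def)

context coordinatized_tree
begin

text \<open>
  One twist for each set of levels; a levelwise commutator of transpositions produces it, with
  \<open>(1 2)\<close> used on the selected levels only.
\<close>

definition selected_twist :: "(nat \<Rightarrow> bool) \<Rightarrow> 'v \<Rightarrow> 'v" where
  "selected_twist x = lift (cone_twist (selection x))"

lemma selected_twist_in_normal:
  assumes G: "group G" and N: "N \<lhd> G" "N \<noteq> {id}" shows "selected_twist x \<in> N"
proof -
  let ?s = "\<lambda>j. if x j then Transposition.transpose 1 2 else (id :: nat \<Rightarrow> nat)"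
  let ?t = "\<lambda>j::nat. Transposition.transpose 2 (3::nat)"
  have "lift (cone_twist (\<lambda>j. ?s j \<circ> ?t j \<circ> inv_into UNIV (?s j) \<circ> inv_into UNIV (?t j))) \<in> N"
    by (rule cone_twist_commutator_in_normal[OF G N])
      (auto intro!: klein_normalizer_id klein_normalizer_transposition)
  moreover have "(\<lambda>j. ?s j \<circ> ?t j \<circ> inv_into UNIV (?s j) \<circ> inv_into UNIV (?t j))
      = selection x"
    by (auto simp: selection_def three_cycle_def fun_eq_iff)
  ultimately show ?thesis by (simp add: selected_twist_def)
qed

lemma selected_twist_in_G: "selected_twist x \<in> carrier G"
  unfolding selected_twist_def
  by (rule cone_twist_in_G) (rule selection_normalizer)

text \<open>
  At a level where \<open>x\<close> and \<open>y\<close> differ, the quotient of the two twists acts locally by a 3-cycle or its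
  inverse.  It fixes a letter without being trivial, so it is not in the Klein group.
\<close>

lemma selected_twist_coset:
  assumes G: "group G" and eq: "inv\<^bsub>G\<^esub> (selected_twist x) \<otimes>\<^bsub>G\<^esub> selected_twist y \<in> U"
  shows "x = y"
proof
  fix j
  let ?q = "\<lambda>j. inv_into UNIV (selection x j) \<circ> selection y j"
  have inv: "inv\<^bsub>G\<^esub> (selected_twist x) = lift (cone_twist (\<lambda>j. inv_into UNIV (selection x j)))"
    unfolding selected_twist_def
    by (rule inv_G_cone_twist[OF G]) (rule selection_normalizer)
  have mem: "cone_twist (selection y) v \<in> vertices" if "v \<in> vertices" for v
    using cone_twist_pair[of "selection y", OF selection_permutes] that by (simp add: inverse_pair_def)
  have "inv\<^bsub>G\<^esub> (selected_twist x) \<otimes>\<^bsub>G\<^esub> selected_twist y = lift (cone_twist ?q)"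
    unfolding inv mult_G unfolding selected_twist_def
    using lift_comp[OF mem] cone_twist_comp[of "selection y", OF selection_permutes] by simp
  then obtain u where u: "u \<in> branch_group" "lift u = lift (cone_twist ?q)" using eq by auto
  have q: "?q k permutes {1..4}" for k by (intro permutes_compose permutes_inv selection_permutes)
  have uq: "u v = cone_twist ?q v" if v: "v \<in> vertices" for v
    using fun_cong[OF u(2), of "\<phi> v"] v branch_group_mem[OF u(1) v] cone_twist_pair[of ?q, OF q]
    by (simp add: inverse_pair_def)
  \<comment> \<open>Any vertex at depth \<open>j\<close> of the cone detects the local action on level \<open>j\<close>.\<close>
  let ?v = "(True, 2 # replicate j 1)"
  have v: "?v \<in> cone_at (True, [2])" "?v \<in> vertices" by (auto simp: cone_at_def in_lists_conv_set)
  obtain f where f: "f \<in> klein_four" "\<And>i. i \<in> {1..4} \<Longrightarrow> u (child ?v i) = child (u ?v) (f i)"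
    using branch_group_child[OF u(1) v(2)] by metis
  have fq: "f i = ?q j i" if i: "i \<in> {1..4}" for i
  proof -
    have "child (u ?v) (f i) = cone_twist ?q (child ?v i)" using f(2)[OF i] uq v(2) i by simp
    also have "\<dots> = child (u ?v) (?q j i)" using cone_twist_child[OF v(1) i, of ?q] uq[OF v(2)] by simp
    finally show ?thesis by simp
  qed
  show "x j = y j"
  proof (rule ccontr)
    assume ne: "x j \<noteq> y j"
    have "inv_into UNIV three_cycle 4 = 4" "inv_into UNIV three_cycle 1 \<noteq> 1"
      using three_cycle_props permutes_inverses[OF three_cycle_props(1)] by metis+
    then have "?q j 4 = 4" "?q j 1 \<noteq> 1" using ne three_cycle_props by (auto simp: selection_def)
    moreover have "f = id" using klein_four_fixed_point[OF f(1), of 4] fq[of 4] \<open>?q j 4 = 4\<close> by simp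
    ultimately show False using fq[of 1] by simp
  qed
qed

lemma U_subgroup: assumes G: "group G" shows "subgroup U G"
proof (rule group.subgroupI[OF G U_subset_G])
  show "U \<noteq> {}" using branch_group_id by blast
next
  fix g assume "g \<in> U"
  then obtain u where u: "u \<in> branch_group" "g = lift u" by blast
  have "inv\<^bsub>G\<^esub> g = lift (inv_into vertices u)"
    unfolding u(2) using branch_group_inv_into[OF u(1)] U_subset_G u(1) by (intro inv_G_lift[OF G]) auto
  then show "inv\<^bsub>G\<^esub> g \<in> U" using branch_group_inv_into[OF u(1)] by blast
next
  fix g h assume "g \<in> U" "h \<in> U"
  then obtain u v where "u \<in> branch_group" "v \<in> branch_group" "g = lift u" "h = lift v" by blast
  then show "g \<otimes>\<^bsub>G\<^esub> h \<in> U" using lift_comp branch_group_comp branch_group_mem by (metis imageI mult_G)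
qed

text \<open>
  The inclusion of \<open>U\<close> is an open map, so \<open>U\<close> is an open subgroup; the selected twists lie in the monolith and in
  pairwise distinct cosets of \<open>U\<close>.
\<close>

lemma monolith_not_sigma_compact:
  assumes \<tau>: "localized_topology H (perm_topology (carrier H)) U \<tau>"
  shows "\<not> sigma_compact_space (subtopology \<tau> (monolith G \<tau>))"
proof
  assume sc: "sigma_compact_space (subtopology \<tau> (monolith G \<tau>))"
  have top: "topological_group G \<tau>"
    using \<tau> by (simp add: localized_topology_def tdlc_group_def)
  then have G: "group G" by (simp add: topological_group_def)
  have "topspace (subtopology (perm_topology (carrier H)) U) = U"
    using U_subset_carrier by (auto simp: perm_topology_def)
  then have "openin (subtopology (perm_topology (carrier H)) U) U" by (metis openin_topspace)
  then have "openin \<tau> U"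
    using \<tau> unfolding localized_topology_def open_map_def by (metis image_ident)
  moreover have "range selected_twist \<subseteq> monolith G \<tau>"
    using selected_twist_in_G selected_twist_in_normal[OF G] by (auto simp: monolith_def simp del: carrier_perm_group)
  moreover have "monolith G \<tau> \<subseteq> carrier G" by (auto simp: monolith_def)
  ultimately have "countable (range selected_twist)"
    using sigma_compact_meets_countably_many_cosets[OF top _ U_subgroup[OF G] _ sc]
      selected_twist_coset[OF G] by blast
  moreover have "inj selected_twist"
  proof (rule injI)
    fix x y assume "selected_twist x = selected_twist y"
    then have "inv\<^bsub>G\<^esub> (selected_twist x) \<otimes>\<^bsub>G\<^esub> selected_twist y = id"
      using inv_G_comp(1)[OF G selected_twist_in_G] by simp
    then show "x = y" using selected_twist_coset[OF G] subgroup.one_closed[OF U_subgroup[OF G]]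
      by (metis one_G)
  qed
  ultimately show False
    using uncountable_binary_sequences countable_image_inj_on by blast
qed

end

section \<open>Coordinates from the two half-trees\<close>

text \<open>
  A coherent sequence in the iterated wreath products is the same as one automorphism of the rooted
  tree whose local action at every word is in \<open>F\<close>: the sequence is recovered by restriction to levels.
\<close>

lemma wreath_branch_local:
  "a \<in> wreath_branch n F \<longleftrightarrow> a permutes lists {1..n} \<and> a [] = [] \<and>
     (\<forall>w\<in>lists {1..n}. \<exists>f\<in>F. \<forall>i\<in>{1..n}. a (w @ [i]) = a w @ [f i])"
  (is "_ \<longleftrightarrow> ?local")
proof
  assume "a \<in> wreath_branch n F"
  then obtain h where perm: "a permutes lists {1..n}"
    and h: "\<And>k. h k \<in> iter_wreath n F k"
      "\<And>k w. w \<in> word_level n (Suc k) \<Longrightarrow> butlast (h (Suc k) w) = h k (butlast w)"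
      "\<And>w. w \<in> lists {1..n} \<Longrightarrow> a w = h (length w) w"
    unfolding wreath_branch_def by blast
  have "a [] = []" using h(1)[of 0] h(3)[of "[]"] by simp
  moreover have "\<exists>f\<in>F. \<forall>i\<in>{1..n}. a (w @ [i]) = a w @ [f i]" if w: "w \<in> lists {1..n}" for w
  proof -
    have wl: "w \<in> word_level n (length w)" using w by (simp add: word_level_def)
    have "h (Suc (length w)) \<in> iter_wreath n F (Suc (length w))" by (rule h(1))
    then obtain h' f where f: "\<forall>w'\<in>word_level n (length w). f w' \<in> F \<and>
        (\<forall>i\<in>{1..n}. h (Suc (length w)) (w' @ [i]) = h' w' @ [f w' i])"
      unfolding iter_wreath.simps by blast
    have "a (w @ [i]) = a w @ [f w i]" if i: "i \<in> {1..n}" for i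
    proof -
      have wi: "w @ [i] \<in> word_level n (Suc (length w))" using w i by (simp add: word_level_def)
      have step: "h (Suc (length w)) (w @ [i]) = h' w @ [f w i]" using f wl i by blast
      moreover have "h' w = h (length w) w" using h(2)[OF wi] step by simp
      ultimately show ?thesis using h(3)[of "w @ [i]"] h(3)[OF w] wi by (simp add: word_level_def)
    qed
    then show ?thesis using f wl by blast
  qed
  ultimately show ?local using perm by blast
next
  assume local: ?local
  then have perm: "a permutes lists {1..n}" and root: "a [] = []" by auto
  obtain f where f: "\<And>w. w \<in> lists {1..n} \<Longrightarrow> f w \<in> F"
      "\<And>w i. w \<in> lists {1..n} \<Longrightarrow> i \<in> {1..n} \<Longrightarrow> a (w @ [i]) = a w @ [f w i]"
    using local by metis
  have len: "length (a w) = length w" if "w \<in> lists {1..n}" for w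
    using that by (induction w rule: rev_induct) (simp_all add: root f)
  define h where "h k w = (if w \<in> word_level n k then a w else w)" for k w
  have h_perm: "h k permutes word_level n k" for k
  proof (rule bij_imp_permutes)
    have "a ` word_level n k \<subseteq> word_level n k"
      using permutes_in_image[OF perm] len by (auto simp: word_level_def)
    moreover have "v \<in> a ` word_level n k" if "v \<in> word_level n k" for v
    proof -
      have "v \<in> a ` lists {1..n}" using that permutes_image[OF perm] by (auto simp: word_level_def)
      then show ?thesis using that len by (auto simp: word_level_def)
    qed
    ultimately have "bij_betw a (word_level n k) (word_level n k)"
      using permutes_inj_on[OF perm] by (auto simp: bij_betw_def)
    then show "bij_betw (h k) (word_level n k) (word_level n k)"
      by (rule bij_betw_cong[THEN iffD1, rotated]) (simp add: h_def)
  qed (simp add: h_def)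
  have "h k \<in> iter_wreath n F k" for k
  proof (induction k)
    case 0
    have "h 0 = id" by (auto simp: h_def word_level_def root)
    then show ?case by (metis iter_wreath.simps(1) singletonI)
  next
    case (Suc k)
    have "\<forall>w\<in>word_level n k. f w \<in> F \<and> (\<forall>i\<in>{1..n}. h (Suc k) (w @ [i]) = h k w @ [f w i])"
      by (auto simp: h_def word_level_def f)
    then show ?case using Suc h_perm unfolding iter_wreath.simps by blast
  qed
  moreover have "butlast (h (Suc k) w) = h k (butlast w)" if "w \<in> word_level n (Suc k)" for k w
  proof (cases w rule: rev_cases)
    case Nil
    then show ?thesis using that by (simp add: word_level_def)
  next
    case (snoc v i)
    then show ?thesis using that f(2)[of v i] by (simp add: word_level_def h_def)
  qed
  moreover have "a w = h (length w) w" if "w \<in> lists {1..n}" for w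
    using that by (simp add: h_def word_level_def)
  ultimately show "a \<in> wreath_branch n F" unfolding wreath_branch_def using perm by blast
qed

lemma rtrancl_on_sym:
  assumes "sym r" "(u, v) \<in> rtrancl_on V r" shows "(v, u) \<in> rtrancl_on V r"
  using assms(2)
proof (induction rule: rtrancl_on_induct)
  case (step y z)
  then show ?case using assms(1) by (auto intro: converse_rtrancl_on_into_rtrancl_on dest: symD)
qed auto

locale edge_coordinates =
  fixes T :: "'v pair_pre_digraph" and e :: "'v \<times> 'v" and \<alpha> \<beta> :: "nat list \<Rightarrow> 'v"
  assumes regular: "regular_tree 5 T" and e: "e \<in> parcs T"
    and \<alpha>: "half_tree_coords 4 T e \<alpha>" and \<beta>: "half_tree_coords 4 T (prod.swap e) \<beta>"
begin

abbreviation "cut_arcs \<equiv> parcs T - {e, prod.swap e}"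

lemma arcs_sym: "(u, v) \<in> parcs T \<Longrightarrow> (v, u) \<in> parcs T"
  and arcs_in: "(u, v) \<in> parcs T \<Longrightarrow> u \<in> pverts T \<and> v \<in> pverts T"
proof -
  interpret pair_bidirected_digraph T using regular by (simp add: regular_tree_def)
  show "(u, v) \<in> parcs T \<Longrightarrow> (v, u) \<in> parcs T"
    using pair_sym_arcs by (auto simp: symmetric_def dest: symD)
  show "(u, v) \<in> parcs T \<Longrightarrow> u \<in> pverts T \<and> v \<in> pverts T"
    using in_arcsD1 in_arcsD2 by blast
qed

lemma half_trees:
  "v \<in> half_tree T e \<longleftrightarrow> (fst e, v) \<in> rtrancl_on (pverts T) cut_arcs"
  "v \<in> half_tree T (prod.swap e) \<longleftrightarrow> (snd e, v) \<in> rtrancl_on (pverts T) cut_arcs"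
  by (simp_all add: half_tree_def reachable_def insert_commute)

lemma ends_in: "fst e \<in> pverts T" "snd e \<in> pverts T"
  using arcs_in[of "fst e" "snd e"] e by simp_all

lemma ends_half_trees: "fst e \<in> half_tree T e" "snd e \<in> half_tree T (prod.swap e)"
  by (simp_all add: half_trees ends_in)

lemma half_trees_cover: "half_tree T e \<union> half_tree T (prod.swap e) = pverts T"
proof
  show "half_tree T e \<union> half_tree T (prod.swap e) \<subseteq> pverts T"
    by (auto simp: half_trees dest: in_rtrancl_on_in_F)
  show "pverts T \<subseteq> half_tree T e \<union> half_tree T (prod.swap e)"
  proof
    fix v assume "v \<in> pverts T"
    then have "(fst e, v) \<in> rtrancl_on (pverts T) (parcs T)"
      using regular ends_in by (simp add: regular_tree_def strongly_connected_def reachable_def)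
    then show "v \<in> half_tree T e \<union> half_tree T (prod.swap e)"
    proof (induction rule: rtrancl_on_induct)
      case base
      then show ?case using ends_half_trees by simp
    next
      case (step y z)
      show ?case
      proof (cases "(y, z) \<in> cut_arcs")
        case True
        then show ?thesis using step by (auto simp: half_trees intro: rtrancl_on_into_rtrancl_on)
      next
        case False
        then have "z = fst e \<or> z = snd e" using step by (auto simp: prod.swap_def)
        then show ?thesis using ends_half_trees by auto
      qed
    qed
  qed
qed

text \<open>
  If the half-trees met, the initial vertex of \<open>e\<close> would reach all vertices without using \<open>e\<close>, so \<open>\<alpha>\<close> would
  parametrize the whole tree.  In these coordinates the root has only four neighbours, not five.
\<close>

lemma half_trees_disjoint: "half_tree T e \<inter> half_tree T (prod.swap e) = {}"
proof (rule ccontr)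
  assume "\<not> ?thesis"
  then obtain v where v: "v \<in> half_tree T e" "v \<in> half_tree T (prod.swap e)" by blast
  have "sym cut_arcs" using arcs_sym by (cases e) (auto intro!: symI)
  then have "(v, snd e) \<in> rtrancl_on (pverts T) cut_arcs" using v(2) rtrancl_on_sym by (auto simp: half_trees)
  then have snd: "(fst e, snd e) \<in> rtrancl_on (pverts T) cut_arcs"
    by (rule rtrancl_on_trans[OF v(1)[unfolded half_trees(1)]])
  have all: "half_tree T e = pverts T"
    using half_trees_cover rtrancl_on_trans[OF snd] by (auto simp: half_trees)
  have "out_arcs (with_proj T) (fst e) \<subseteq> (\<lambda>i. (\<alpha> [], \<alpha> [i])) ` {1..4}"
  proof
    fix a assume "a \<in> out_arcs (with_proj T) (fst e)"
    then have a: "(fst e, snd a) \<in> parcs T" "a = (fst e, snd a)" by (cases a, auto simp: out_arcs_def)+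
    then have "snd a \<in> half_tree T e" using arcs_in all by blast
    then obtain w where w: "w \<in> lists {1..4}" "snd a = \<alpha> w"
      using \<alpha> unfolding half_tree_coords_def bij_betw_def by blast
    have root: "\<alpha> [] = fst e" using \<alpha> by (simp add: half_tree_coords_def)
    have "(\<alpha> [], \<alpha> w) \<in> parcs T" using a(1) w root by simp
    moreover have "(\<alpha> [], \<alpha> w) \<in> parcs T \<longleftrightarrow> (\<exists>i. w = [] @ [i] \<or> [] = w @ [i])"
      using \<alpha> w(1) unfolding half_tree_coords_def by blast
    ultimately obtain i where "w = [i]" by auto
    then show "a \<in> (\<lambda>i. (\<alpha> [], \<alpha> [i])) ` {1..4}" using a(2) w root by auto
  qed
  then have "card (out_arcs (with_proj T) (fst e)) \<le> card ((\<lambda>i. (\<alpha> [], \<alpha> [i])) ` {1..4::nat})"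
    by (intro card_mono) auto
  also have "\<dots> \<le> 4" using card_image_le[of "{1..4::nat}"] by simp
  finally show False using regular ends_in by (simp add: regular_tree_def)
qed

definition coords :: "bool \<times> nat list \<Rightarrow> 'v" where
  "coords x = (if fst x then \<alpha> (snd x) else \<beta> (snd x))"

lemma coords_side:
  assumes "w \<in> lists {1..4}"
  shows "\<alpha> w \<in> half_tree T e" "\<beta> w \<in> half_tree T (prod.swap e)"
  using \<alpha> \<beta> assms by (auto simp: half_tree_coords_def bij_betw_def)

lemma coords_inj:
  assumes "v \<in> lists {1..4}" "w \<in> lists {1..4}"
  shows "\<alpha> v = \<alpha> w \<longleftrightarrow> v = w" "\<beta> v = \<beta> w \<longleftrightarrow> v = w"
  using \<alpha> \<beta> assms by (auto simp: half_tree_coords_def bij_betw_def inj_on_def)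

lemma coords_roots: "\<alpha> [] = fst e" "\<beta> [] = snd e"
  using \<alpha> \<beta> by (auto simp: half_tree_coords_def)

lemma cross_arc:
  assumes "v \<in> lists {1..4}" "w \<in> lists {1..4}"
  shows "(\<alpha> v, \<beta> w) \<in> parcs T \<longleftrightarrow> v = [] \<and> w = []"
proof
  assume arc: "(\<alpha> v, \<beta> w) \<in> parcs T"
  have sides: "\<alpha> v \<notin> half_tree T (prod.swap e)" "\<beta> w \<notin> half_tree T e"
    using coords_side assms half_trees_disjoint by blast+
  have "(\<alpha> v, \<beta> w) \<notin> cut_arcs"
    using sides(2) coords_side(1)[OF assms(1)] rtrancl_on_into_rtrancl_on arcs_in[OF arc]
    by (metis half_trees(1))
  then have "(\<alpha> v, \<beta> w) = e \<or> (\<alpha> v, \<beta> w) = prod.swap e" using arc by blast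
  then have "\<alpha> v = fst e" "\<beta> w = snd e"
    using sides(1) ends_half_trees(2) by (auto simp: prod.swap_def)
  then show "v = [] \<and> w = []"
    using coords_inj(1)[of v "[]"] coords_inj(2)[of w "[]"] assms by (simp add: coords_roots)
qed (use e in \<open>simp add: coords_roots\<close>)

sublocale coordinatized_tree T coords
proof
  show "bij_betw coords vertices (pverts T)"
    unfolding bij_betw_def
  proof
    show "inj_on coords vertices"
    proof (rule inj_onI)
      fix x y assume xy: "x \<in> vertices" "y \<in> vertices" "coords x = coords y"
      obtain b v c w where p: "x = (b, v)" "y = (c, w)" by fastforce
      have m: "v \<in> lists {1..4}" "w \<in> lists {1..4}" using xy p by simp_all
      have "b = c"
        using xy(3) coords_side[OF m(1)] coords_side[OF m(2)] half_trees_disjoint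
        by (cases b; cases c) (auto simp: coords_def p)
      then show "x = y" using xy(3) coords_inj[OF m] by (cases b) (auto simp: coords_def p)
    qed
    have split: "vertices = Pair True ` lists {1..4} \<union> Pair False ` lists {1..4}"
      unfolding vertices_def UNIV_bool by blast
    have "coords ` vertices = \<alpha> ` lists {1..4} \<union> \<beta> ` lists {1..4}"
      unfolding split image_Un image_image by (simp add: coords_def)
    then show "coords ` vertices = pverts T"
      using \<alpha> \<beta> half_trees_cover by (simp add: half_tree_coords_def bij_betw_def)
  qed
  fix x y assume xy: "x \<in> vertices" "y \<in> vertices"
  obtain b v c w where p: "x = (b, v)" "y = (c, w)" by fastforce
  have m: "v \<in> lists {1..4}" "w \<in> lists {1..4}" using xy p by simp_all
  have cross: "(\<beta> v, \<alpha> w) \<in> parcs T \<longleftrightarrow> v = [] \<and> w = []"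
    using cross_arc[OF m(2,1)] arcs_sym by blast
  show "(coords x, coords y) \<in> parcs T \<longleftrightarrow> adjacent x y"
  proof (cases "b = c")
    case True
    then show ?thesis
      using \<alpha> \<beta> m by (cases b) (auto simp: half_tree_coords_def coords_def p adjacent_def child_def)
  next
    case False
    then show ?thesis
      using cross_arc[OF m] cross by (cases b) (auto simp: coords_def p adjacent_def child_def)
  qed
qed

lemma half_trees_action_lift:
  "half_trees_action 4 T e \<alpha> \<beta> (a, b) = lift (\<lambda>(s, w). (s, if s then a w else b w))"
proof
  fix v
  have inv: "inv_into (lists {1..4}) \<alpha> (\<alpha> w) = w" "inv_into (lists {1..4}) \<beta> (\<beta> w) = w"
    if "w \<in> lists {1..4}" for w
    using \<alpha> \<beta> that by (simp_all add: half_tree_coords_def bij_betw_def)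
  show "half_trees_action 4 T e \<alpha> \<beta> (a, b) v = lift (\<lambda>(s, w). (s, if s then a w else b w)) v"
  proof (cases "v \<in> pverts T")
    case True
    then obtain x where x: "x \<in> vertices" "v = coords x" using \<phi>_cases by metis
    obtain s w where p: "x = (s, w)" by fastforce
    have w: "w \<in> lists {1..4}" using x p by simp
    have "\<beta> w \<notin> half_tree T e" using coords_side(2)[OF w] half_trees_disjoint by blast
    then show ?thesis
      unfolding x(2) lift_apply[OF x(1)]
      using coords_side[OF w] inv[OF w] by (simp add: half_trees_action_def p coords_def)
  next
    case False
    then have "v \<notin> half_tree T e" "v \<notin> half_tree T (prod.swap e)" using half_trees_cover by auto
    then show ?thesis using False by (simp add: half_trees_action_def)
  qed
qed

lemma wreath_square_klein_four: "wreath_square 4 T e \<alpha> \<beta> klein_four = U"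
proof
  show "wreath_square 4 T e \<alpha> \<beta> klein_four \<subseteq> U"
  proof
    fix g assume "g \<in> wreath_square 4 T e \<alpha> \<beta> klein_four"
    then obtain a b where ab: "a \<in> wreath_branch 4 klein_four" "b \<in> wreath_branch 4 klein_four"
        "g = half_trees_action 4 T e \<alpha> \<beta> (a, b)"
      by (auto simp: wreath_square_def)
    let ?m = "\<lambda>(s, w). (s, if s then a w else b w)"
    note A = ab(1)[unfolded wreath_branch_local] and B = ab(2)[unfolded wreath_branch_local]
    have perm: "a permutes lists {1..4}" "b permutes lists {1..4}" using A B by simp_all
    have stays: "a w \<in> lists {1..4}" "b w \<in> lists {1..4}"
      "inv_into UNIV a w \<in> lists {1..4}" "inv_into UNIV b w \<in> lists {1..4}"
      if "w \<in> lists {1..4}" for w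
      using that perm permutes_inv permutes_in_image by metis+
    have "inverse_pair ?m (\<lambda>(s, w). (s, if s then inv_into UNIV a w else inv_into UNIV b w))"
      unfolding inverse_pair_def
    proof
      fix x :: "bool \<times> nat list" assume x: "x \<in> vertices"
      obtain s w where "x = (s, w)" "w \<in> lists {1..4}" using x by (metis prod.collapse vertices_iff)
      then show "?m x \<in> vertices \<and>
          (case x of (s, w) \<Rightarrow> (s, if s then inv_into UNIV a w else inv_into UNIV b w)) \<in> vertices \<and>
          (case ?m x of (s, w) \<Rightarrow> (s, if s then inv_into UNIV a w else inv_into UNIV b w)) = x \<and>
          ?m (case x of (s, w) \<Rightarrow> (s, if s then inv_into UNIV a w else inv_into UNIV b w)) = x"
        using stays[of w] permutes_inverses[OF perm(1)] permutes_inverses[OF perm(2)]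
        by (cases s) simp_all
    qed
    moreover have "\<exists>f\<in>klein_four. \<forall>i\<in>{1..4}. ?m (child x i) = child (?m x) (f i)"
      if x: "x \<in> vertices" for x
    proof -
      obtain s w where p: "x = (s, w)" "w \<in> lists {1..4}" using x by (metis prod.collapse vertices_iff)
      then obtain f where "f \<in> klein_four"
          "\<forall>i\<in>{1..4}. (if s then a else b) (w @ [i]) = (if s then a else b) w @ [f i]"
        using A B by (cases s) auto
      then show ?thesis using p by (intro bexI[of _ f]) (auto simp: child_def)
    qed
    ultimately have "?m \<in> branch_group" using A B by (intro branch_groupI) auto
    then show "g \<in> U" using ab(3) half_trees_action_lift by blast
  qed
  show "U \<subseteq> wreath_square 4 T e \<alpha> \<beta> klein_four"
  proof
    fix g assume "g \<in> U"
    then obtain u where u: "u \<in> branch_group" "g = lift u" by blast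
    define a where "a s w = (if w \<in> lists {1..4} then snd (u (s, w)) else w)" for s w
    have ua: "u (s, w) = (s, a s w)" if "w \<in> lists {1..4}" for s w
      using branch_group_level[OF u(1), of "(s, w)"] that by (simp add: a_def prod_eq_iff)
    have "a s \<in> wreath_branch 4 klein_four" for s
      unfolding wreath_branch_local
    proof (intro conjI ballI)
      have "bij_betw (a s) (lists {1..4}) (lists {1..4})"
      proof (rule bij_betw_byWitness)
        let ?u' = "inv_into vertices u"
        note u' = branch_group_inv_into[OF u(1)]
        have u's: "?u' (s, w) = (s, snd (?u' (s, w)))" if "w \<in> lists {1..4}" for w
          using branch_group_level[OF u'(2), of "(s, w)"] that by (simp add: prod_eq_iff)
        have mem: "a s w \<in> lists {1..4}" "snd (?u' (s, w)) \<in> lists {1..4}" if "w \<in> lists {1..4}" for w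
          using branch_group_mem[OF u(1), of "(s, w)"] branch_group_mem[OF u'(2), of "(s, w)"] that
            ua[OF that] u's[OF that] by (metis vertices_iff)+
        have "?u' (u (s, w)) = (s, w)" "u (?u' (s, w)) = (s, w)" if "w \<in> lists {1..4}" for w
        proof -
          have "(s, w) \<in> vertices" using that by simp
          then show "?u' (u (s, w)) = (s, w)" "u (?u' (s, w)) = (s, w)"
            using u'(1) unfolding inverse_pair_def by blast+
        qed
        note round = this
        show "\<forall>w\<in>lists {1..4}. snd (?u' (s, a s w)) = w"
          using round(1) ua by simp
        show "\<forall>w\<in>lists {1..4}. a s (snd (?u' (s, w))) = w"
        proof
          fix w assume w: "w \<in> lists {1..(4::nat)}"
          have "(s, a s (snd (?u' (s, w)))) = u (s, snd (?u' (s, w)))" by (simp add: ua[OF mem(2)[OF w]])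
          also have "\<dots> = (s, w)" using round(2)[OF w] u's[OF w] by simp
          finally show "a s (snd (?u' (s, w))) = w" by simp
        qed
        show "a s ` lists {1..4} \<subseteq> lists {1..4}"
          "(\<lambda>w. snd (?u' (s, w))) ` lists {1..4} \<subseteq> lists {1..4}" using mem by auto
      qed
      then show "a s permutes lists {1..4}" by (rule bij_imp_permutes) (simp add: a_def)
      show "a s [] = []" using branch_group_root[OF u(1)] by (simp add: a_def)
      fix w assume w: "w \<in> lists {1..(4::nat)}"
      then obtain f where f: "f \<in> klein_four"
          "\<And>i. i \<in> {1..4} \<Longrightarrow> u (child (s, w) i) = child (u (s, w)) (f i)"
        using branch_group_child[OF u(1), of "(s, w)"] by (metis vertices_iff)
      have "a s (w @ [i]) = a s w @ [f i]" if i: "i \<in> {1..4}" for i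
        using f(2)[OF i] w i ua[OF w, of s] ua[of "w @ [i]" s] by (simp add: child_def)
      then show "\<exists>f\<in>klein_four. \<forall>i\<in>{1..4}. a s (w @ [i]) = a s w @ [f i]" using f(1) by blast
    qed
    moreover have "g = half_trees_action 4 T e \<alpha> \<beta> (a True, a False)"
      unfolding half_trees_action_lift u(2)
      by (rule lift_eqI) (auto simp: ua)
    ultimately show "g \<in> wreath_square 4 T e \<alpha> \<beta> klein_four" unfolding wreath_square_def by blast
  qed
qed

end

section \<open>Conclusion\<close>

theorem proposition9p3p1:
  fixes T :: "'v pair_pre_digraph"
    and c :: "'v \<times> 'v \<Rightarrow> nat"
    and e :: "'v \<times> 'v"
    and \<alpha> \<beta> :: "nat list \<Rightarrow> 'v"
    and L U M :: "('v \<Rightarrow> 'v) set"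
    and H G :: "('v \<Rightarrow> 'v) monoid"
    and \<tau> :: "('v \<Rightarrow> 'v) topology"
  assumes "regular_tree 5 T"
    and "legal_coloring 5 T c"
    and "e \<in> parcs T"
    and "H = perm_group (tree_aut_plus T)"
    and "L = universal_group 5 T c (carrier (alt_group 5))"
    and "half_tree_coords 4 T e \<alpha>"
    and "half_tree_coords 4 T (prod.swap e) \<beta>"
    and "edge_stabilizer e L = wreath_square 4 T e \<alpha> \<beta> (carrier (alt_group 4))"
    and "U = wreath_square 4 T e \<alpha> \<beta> klein_four"
    and "G = H\<lparr>carrier := commensurator H U\<rparr>"
    and "localized_topology H (perm_topology (carrier H)) U \<tau>"
    and "M = monolith G \<tau>"
  shows "\<not> sigma_compact_space (subtopology \<tau> M)"
proof -
  interpret edge_coordinates T e \<alpha> \<beta> using assms by unfold_locales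
  have U: "U = wreath_square 4 T e \<alpha> \<beta> klein_four" using assms by simp
  show ?thesis
    using monolith_not_sigma_compact[of \<tau>] assms(4,10-12) U wreath_square_klein_four by simp
qed

end
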